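(* Let $\mu$ be a finitely supported probability measure on $\mathsf{Shuffler}(\mathbb{Z}^2)=\mathrm{FSym}(\mathbb{Z}^2)\rtimes\mathbb{Z}^2$ such that its projection to $\mathbb{Z}^2$ induces a recurrent random walk. Then the Poisson boundary of $(\mathsf{Shuffler}(\mathbb{Z}^2),\mu)$ is trivial.
   Context: $\mathrm{FSym}(\mathbb{Z}^2)$ is the group (under composition) of bijections $f:\mathbb{Z}^2\to\mathbb{Z}^2$ that are the identity outside a finite set. $\mathbb{Z}^2$ acts on it by $(h\cdot f)(x)=h+f(x-h)$, and $\mathsf{Shuffler}(\mathbb{Z}^2):=\mathrm{FSym}(\mathbb{Z}^2)\rtimes\mathbb{Z}^2$ with product $(f,x)(g,y)=(f\circ(x\cdot g),x+y)$. For a probability measure $\mu$ on a countable group $G$, the $\mu$-random walk is $x_n=g_1\cdots g_n$ with $g_i$ i.i.d. of law $\mu$, started at $e_G$; $\mathbb{P}$ is the law of $(x_1,x_2,\dots)$ on $G^\infty$. The random walk induced on $\mathbb{Z}^2$ is driven by the push-forward of $\mu$ under the projection $\mathsf{Shuffler}(\mathbb{Z}^2)\to\mathbb{Z}^2$; it is recurrent if almost surely it visits the identity infinitely often. No non-degeneracy of $\mu$ is assumed. The Poisson boundary of $(G,\mu)$ is the space of ergodic components of the shift $T(x_1,x_2,\dots)=(x_2,x_3,\dots)$ on $(G^\infty,\mathbb{P})$; it is trivial if every shift-invariant event has $\mathbb{P}$-probability $0$ or $1$. *)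

theory Defs
  imports "HOL-Probability.Probability" "HOL-Algebra.Elementary_Groups"
begin

abbreviation Z2 :: "(int \<times> int) monoid" where
  "Z2 \<equiv> integer_group \<times>\<times> integer_group"

definition FSym_Z2 :: "(int \<times> int \<Rightarrow> int \<times> int) monoid" where
  "FSym_Z2 = \<lparr>carrier = {f. bij f \<and> finite {x. f x \<noteq> x}}, monoid.mult = (\<circ>), one = id\<rparr>"

(* the action (h . f)(x) = h + f(x - h); + and - on pairs are componentwise *)
definition translate :: "int \<times> int \<Rightarrow> (int \<times> int \<Rightarrow> int \<times> int) \<Rightarrow> (int \<times> int \<Rightarrow> int \<times> int)" where
  "translate h f = (\<lambda>x. h + f (x - h))"

definition Shuffler_Z2 :: "((int \<times> int \<Rightarrow> int \<times> int) \<times> (int \<times> int)) monoid" where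
  "Shuffler_Z2 =
     \<lparr>carrier = carrier FSym_Z2 \<times> carrier Z2,
      monoid.mult = (\<lambda>(f, x) (g, y). (f \<otimes>\<^bsub>FSym_Z2\<^esub> translate x g, x \<otimes>\<^bsub>Z2\<^esub> y)),
      one = (\<one>\<^bsub>FSym_Z2\<^esub>, \<one>\<^bsub>Z2\<^esub>)\<rparr>"

primrec increment_prod :: "('a, 'b) monoid_scheme \<Rightarrow> (nat \<Rightarrow> 'a) \<Rightarrow> nat \<Rightarrow> 'a" where
  "increment_prod G g 0 = \<one>\<^bsub>G\<^esub>"
| "increment_prod G g (Suc n) = increment_prod G g n \<otimes>\<^bsub>G\<^esub> g n"

(* The increments g_1, g_2, ... and the path x_1, x_2, ... are indexed from 0 here: entry n of a
   sequence is its term number n + 1, so the starting point e is not part of the path.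
   The factors live on the carrier, which is countable, and not on the whole type 'a, which need
   not be: otherwise multiplication could fail to be measurable for the product sigma-algebra. *)
definition walk_law :: "('a, 'b) monoid_scheme \<Rightarrow> 'a pmf \<Rightarrow> (nat \<Rightarrow> 'a) measure" where
  "walk_law G \<mu> =
     distr (\<Pi>\<^sub>M i\<in>UNIV. restrict_space (measure_pmf \<mu>) (carrier G))
           (\<Pi>\<^sub>M i\<in>UNIV. count_space (carrier G))
           (\<lambda>g n. increment_prod G g (Suc n))"

definition recurrent_walk :: "('a, 'b) monoid_scheme \<Rightarrow> 'a pmf \<Rightarrow> bool" where
  "recurrent_walk G \<mu> \<longleftrightarrow> (AE x in walk_law G \<mu>. \<exists>\<^sub>\<infinity>n. x n = \<one>\<^bsub>G\<^esub>)"

definition path_shift :: "(nat \<Rightarrow> 'a) \<Rightarrow> (nat \<Rightarrow> 'a)" where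
  "path_shift x = (\<lambda>n. x (Suc n))"

(* Invariance is exact, not up to null sets: the shift need not preserve walk_law. *)
definition shift_invariant_events :: "('a, 'b) monoid_scheme \<Rightarrow> 'a pmf \<Rightarrow> (nat \<Rightarrow> 'a) set set" where
  "shift_invariant_events G \<mu> =
     {A \<in> sets (walk_law G \<mu>). path_shift -` A \<inter> space (walk_law G \<mu>) = A}"

definition trivial_Poisson_boundary :: "('a, 'b) monoid_scheme \<Rightarrow> 'a pmf \<Rightarrow> bool" where
  "trivial_Poisson_boundary G \<mu> \<longleftrightarrow>
     (\<forall>A\<in>shift_invariant_events G \<mu>. measure (walk_law G \<mu>) A = 0 \<or> measure (walk_law G \<mu>) A = 1)"

end

(* By the entropy criterion of Kaimanovich--Vershik and Derriennic it suffices that the entropy H_n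
   of the position at time n is o(n): by a Pinsker-type inequality H_{n+1} - H_n bounds the mean
   squared change of a bounded harmonic function over one step, so such functions are constant
   along the walk and an invariant event is independent of every finite initial segment. Let R be
   the set of the points of Z^2 visited up to time n. The permutation f reached at time n moves
   only points near R, and its total displacement, the sum of |f(y) - y|, is at most C n, because
   displacement is subadditive and translation-invariant. Recurrence gives |R| = o(n) with high
   probability. The steps are bounded, so R is covered by a tour of length at most 2|R| and there
   are only exp(O(|R|)) choices for R; given R, a generating function shows that there are
   exp(o(n)) functions on a set of size O(|R|) with total norm at most C n. *)
theory Submission
  imports Defs
begin

section \<open>Entropy of finitely supported distributions\<close>

text \<open>The naive count fails at the borderline: for simple random walk on Z^2 the range is of
  order n / log n, so already log |R|! is of order n, and permuting R freely is too much. The linear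
  bound on the displacement beats this. Give a displacement vector v the weight a^|v| with a < 1.
  Undoing the weights costs a^(-C n), at most exp(epsilon n / 4) once a is close enough to 1; after
  that each point costs a factor that depends on a alone, which is harmless for o(n) points. This
  fixes the order of choices: a from epsilon and C, then the tolerated proportion of visited points
  from a, and the time n last. A large range is unlikely but not impossible, so the count cannot
  cover the whole support of the position at time n. Entropy absorbs the exceptional event: it
  contributes its small probability times the trivial bound n ln |supp mu|.\<close>

definition pmf_entropy :: "'a pmf \<Rightarrow> real" where
  "pmf_entropy p = (\<Sum>x\<in>set_pmf p. pmf p x * ln (1 / pmf p x))"

text \<open>Gibbs' inequality, from ln t \<le> t - 1 at t = \<open>w x / pmf p x\<close>. Allowing
  total weight below 1 spares normalising the weights to which it is applied.\<close>

lemma pmf_entropy_le_cross_entropy: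
  assumes fin: "finite (set_pmf p)" and pos: "\<And>x. x \<in> set_pmf p \<Longrightarrow> w x > 0"
    and sum: "sum w (set_pmf p) \<le> 1"
  shows "pmf_entropy p \<le> (\<Sum>x\<in>set_pmf p. pmf p x * ln (1 / w x))"
proof -
  have *: "pmf p x * ln (1 / pmf p x) - pmf p x * ln (1 / w x) \<le> w x - pmf p x"
    if x: "x \<in> set_pmf p" for x
  proof -
    have p: "pmf p x > 0" using x by (simp add: pmf_positive)
    have "ln (1 / pmf p x) - ln (1 / w x) = ln (w x / pmf p x)"
      using p pos[OF x] by (simp add: ln_div)
    also have "\<dots> \<le> w x / pmf p x - 1"
      using p pos[OF x] by (intro ln_le_minus_one) auto
    finally have "pmf p x * (ln (1 / pmf p x) - ln (1 / w x)) \<le> pmf p x * (w x / pmf p x - 1)"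
      using p by (intro mult_left_mono) auto
    then show ?thesis using p by (simp add: algebra_simps)
  qed
  have "pmf_entropy p - (\<Sum>x\<in>set_pmf p. pmf p x * ln (1 / w x)) \<le> (\<Sum>x\<in>set_pmf p. w x - pmf p x)"
    unfolding pmf_entropy_def sum_subtractf[symmetric] by (intro sum_mono *)
  also have "\<dots> = sum w (set_pmf p) - 1"
    using fin by (simp add: sum_subtractf sum_pmf_eq_1)
  finally show ?thesis using sum by simp
qed

text \<open>A two-part code: ln 2 pays for announcing whether the point lies in \<open>S\<close>,
  then the point is coded uniformly in \<open>S\<close> or in the whole support. The second,
  expensive case is weighted by the probability of leaving \<open>S\<close>.\<close>

lemma pmf_entropy_le_concentration:
  assumes fin: "finite (set_pmf p)" and S: "finite S" "S \<noteq> {}" and K: "card (set_pmf p) \<le> K"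
  shows "pmf_entropy p \<le> ln 2 + ln (card S) + measure_pmf.prob p (- S) * ln K"
proof -
  define T where "T = set_pmf p"
  have T: "finite T" "T \<noteq> {}" using fin by (auto simp: T_def set_pmf_not_empty)
  \<comment> \<open>Each of the two uniform distributions gets half of the mass; where
    \<open>S\<close> and the support overlap some mass is lost, so the total is only bounded by
    1.\<close>
  define w where "w x = (if x \<in> S then 1 / (2 * real (card S)) else 1 / (2 * real (card T)))" for x
  have cS: "real (card S) > 0" and cT: "real (card T) > 0"
    using S T by (auto simp: card_gt_0_iff)
  have "sum w T = sum w (T \<inter> S) + sum w (T - S)"
    using T by (subst sum.union_disjoint[symmetric]) (auto intro: sum.cong)
  also have "\<dots> = card (T \<inter> S) / (2 * card S) + card (T - S) / (2 * card T)"
    by (simp add: w_def)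
  also have "\<dots> \<le> card S / (2 * card S) + card T / (2 * card T)"
    using S T by (intro add_mono divide_right_mono) (auto intro: card_mono)
  also have "\<dots> = 1" using cS cT by simp
  finally have "sum w T \<le> 1" .
  then have "pmf_entropy p \<le> (\<Sum>x\<in>T. pmf p x * ln (1 / w x))"
    unfolding T_def using cS cT
    by (intro pmf_entropy_le_cross_entropy fin) (auto simp: w_def T_def)
  also have "\<dots> \<le> (\<Sum>x\<in>T. pmf p x * (ln 2 + ln (card S) + indicator (-S) x * ln (card T)))"
  proof (intro sum_mono mult_left_mono)
    fix x
    have "ln (card S) \<ge> 0" using cS by (simp add: ln_ge_zero Suc_leI)
    then show "ln (1 / w x) \<le> ln 2 + ln (card S) + indicator (-S) x * ln (card T)"
      using cS cT by (auto simp: w_def ln_mult)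
  qed auto
  also have "\<dots> = ln 2 + ln (card S) + (\<Sum>x\<in>T. pmf p x * indicator (-S) x) * ln (card T)"
    using T by (simp add: distrib_left sum.distrib sum_distrib_right[symmetric] sum_pmf_eq_1 T_def
        mult.assoc[symmetric])
  also have "(\<Sum>x\<in>T. pmf p x * indicator (-S) x) = measure_pmf.prob p (- S)"
  proof -
    have "measure_pmf.prob p (- S) = measure_pmf.expectation p (indicator (-S))" by simp
    also have "\<dots> = (\<Sum>x\<in>T. indicator (-S) x * pmf p x)"
      using T by (intro integral_measure_pmf_real) (auto simp: T_def)
    finally show ?thesis by (simp add: mult.commute)
  qed
  also have "ln 2 + ln (card S) + measure_pmf.prob p (- S) * ln (card T)
      \<le> ln 2 + ln (card S) + measure_pmf.prob p (- S) * ln K"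
    using cT K by (intro add_mono mult_left_mono) (auto simp: T_def)
  finally show ?thesis .
qed

lemma pmf_entropy_nonneg: "pmf_entropy p \<ge> 0"
  unfolding pmf_entropy_def
  by (intro sum_nonneg mult_nonneg_nonneg) (auto simp: pmf_positive pmf_le_1 intro!: ln_ge_zero)

lemma pmf_entropy_map_inj:
  assumes "inj_on f (set_pmf p)"
  shows "pmf_entropy (map_pmf f p) = pmf_entropy p"
  unfolding pmf_entropy_def using assms
  by (simp add: sum.reindex) (intro sum.cong refl, simp add: pmf_map_inj)

text \<open>Pinsker's inequality up to the constant, by comparing with the Hellinger distance.\<close>

lemma expectation_diff_le_relative_entropy:
  fixes f :: "'a \<Rightarrow> real"
  assumes fin: "finite (set_pmf q)" and sub: "set_pmf p \<subseteq> set_pmf q"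
    and f: "\<And>x. \<bar>f x\<bar> \<le> 1"
  shows "(measure_pmf.expectation p f - measure_pmf.expectation q f)\<^sup>2
    \<le> 4 * (\<Sum>x\<in>set_pmf p. pmf p x * ln (pmf p x / pmf q x))"
proof -
  define T where "T = set_pmf q"
  have T: "finite T" using fin by (simp add: T_def)
  have p1: "(\<Sum>x\<in>T. pmf p x) = 1" and q1: "(\<Sum>x\<in>T. pmf q x) = 1"
    using fin sub by (auto simp: T_def intro: sum_pmf_eq_1)
  \<comment> \<open>Factoring p - q as (sqrt p - sqrt q)(sqrt p + sqrt q) lets Cauchy-Schwarz split
    off the squared Hellinger distance; the other factor contributes at most 4.\<close>
  define a where "a x = sqrt (pmf p x) - sqrt (pmf q x)" for x
  define b where "b x = sqrt (pmf p x) + sqrt (pmf q x)" for x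
  have ab: "a x * b x = pmf p x - pmf q x" for x
    by (simp add: a_def b_def algebra_simps flip: real_sqrt_mult)
  have "measure_pmf.expectation p f = (\<Sum>x\<in>T. f x * pmf p x)"
    using T sub by (intro integral_measure_pmf_real) (auto simp: T_def)
  moreover have "measure_pmf.expectation q f = (\<Sum>x\<in>T. f x * pmf q x)"
    using T by (intro integral_measure_pmf_real) (auto simp: T_def)
  ultimately have "measure_pmf.expectation p f - measure_pmf.expectation q f
      = (\<Sum>x\<in>T. a x * (f x * b x))"
    by (simp add: sum_subtractf[symmetric] algebra_simps flip: right_diff_distrib ab)
  then have "(measure_pmf.expectation p f - measure_pmf.expectation q f)\<^sup>2
      \<le> (\<Sum>x\<in>T. (a x)\<^sup>2) * (\<Sum>x\<in>T. (f x * b x)\<^sup>2)"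
    by (simp add: Cauchy_Schwarz_ineq_sum)
  also have "\<dots> \<le> (\<Sum>x\<in>T. (a x)\<^sup>2) * 4"
  proof (intro mult_left_mono sum_nonneg)
    have "(\<Sum>x\<in>T. (f x * b x)\<^sup>2) \<le> (\<Sum>x\<in>T. 2 * (pmf p x + pmf q x))"
    proof (intro sum_mono)
      fix x
      have "(f x * b x)\<^sup>2 \<le> 1 * (b x)\<^sup>2"
        using f[of x] unfolding power_mult_distrib
        by (intro mult_right_mono) (auto simp: abs_square_le_1)
      also have "\<dots> \<le> (b x)\<^sup>2 + (a x)\<^sup>2" by simp
      also have "\<dots> = 2 * (pmf p x + pmf q x)"
        by (simp add: a_def b_def power2_sum power2_diff)
      finally show "(f x * b x)\<^sup>2 \<le> 2 * (pmf p x + pmf q x)" .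
    qed
    also have "\<dots> = 4" by (simp add: sum_distrib_left[symmetric] sum.distrib p1 q1)
    finally show "(\<Sum>x\<in>T. (f x * b x)\<^sup>2) \<le> 4" .
  qed auto
  also have "(\<Sum>x\<in>T. (a x)\<^sup>2) = 2 - 2 * (\<Sum>x\<in>T. sqrt (pmf p x * pmf q x))"
    by (simp add: a_def power2_diff sum.distrib sum_subtractf p1 q1 sum_distrib_left
        real_sqrt_mult mult.assoc)
  also have "(\<Sum>x\<in>T. sqrt (pmf p x * pmf q x)) = (\<Sum>x\<in>set_pmf p. sqrt (pmf p x * pmf q x))"
    using T sub by (intro sum.mono_neutral_right) (auto simp: T_def set_pmf_eq)
  also have "2 - 2 * \<dots> = (\<Sum>x\<in>set_pmf p. 2 * (pmf p x - sqrt (pmf p x * pmf q x)))"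
    using finite_subset[OF sub fin]
    by (simp add: sum_subtractf sum_distrib_left[symmetric] sum_pmf_eq_1 right_diff_distrib)
  also have "\<dots> \<le> (\<Sum>x\<in>set_pmf p. pmf p x * ln (pmf p x / pmf q x))"
  proof (intro sum_mono)
    fix x assume x: "x \<in> set_pmf p"
    have pq: "pmf p x > 0" "pmf q x > 0" using x sub by (auto simp: pmf_positive)
    \<comment> \<open>Taking the logarithm of the square root produces the factor 2 that matches the
      Hellinger term.\<close>
    have "ln (sqrt (pmf q x / pmf p x)) \<le> sqrt (pmf q x / pmf p x) - 1"
      using pq by (intro ln_le_minus_one) auto
    then have "2 - 2 * sqrt (pmf q x / pmf p x) \<le> ln (pmf p x / pmf q x)"
      using pq by (simp add: ln_sqrt ln_div)
    then have "pmf p x * (2 - 2 * sqrt (pmf q x / pmf p x)) \<le> pmf p x * ln (pmf p x / pmf q x)"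
      using pq by (intro mult_left_mono) auto
    moreover have "pmf p x * sqrt (pmf q x / pmf p x) = sqrt (pmf p x * pmf q x)"
      using pq by (simp add: real_sqrt_divide real_sqrt_mult field_simps)
    ultimately show "2 * (pmf p x - sqrt (pmf p x * pmf q x)) \<le> pmf p x * ln (pmf p x / pmf q x)"
      by (simp add: algebra_simps)
  qed
  finally show ?thesis by (simp add: mult.commute)
qed

text \<open>The bracket on the right is the mutual information between the index \<open>s\<close>
  and a sample of the mixture. It equals the mean relative entropy of \<open>P s\<close> with
  respect to the mixture, so Pinsker's inequality applies to each \<open>s\<close>.\<close>

lemma expectation_diff_le_entropy_gap:
  fixes f :: "'b \<Rightarrow> real"
  assumes fin: "finite (set_pmf \<mu>)" and finP: "\<And>s. s \<in> set_pmf \<mu> \<Longrightarrow> finite (set_pmf (P s))"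
    and f: "\<And>x. \<bar>f x\<bar> \<le> 1"
  shows "(\<Sum>s\<in>set_pmf \<mu>. pmf \<mu> s *
      (measure_pmf.expectation (P s) f - measure_pmf.expectation (bind_pmf \<mu> P) f)\<^sup>2)
    \<le> 4 * (pmf_entropy (bind_pmf \<mu> P) - (\<Sum>s\<in>set_pmf \<mu>. pmf \<mu> s * pmf_entropy (P s)))"
proof -
  define Q where "Q = bind_pmf \<mu> P"
  have setQ: "set_pmf Q = (\<Union>s\<in>set_pmf \<mu>. set_pmf (P s))" by (simp add: Q_def)
  then have finQ: "finite (set_pmf Q)" using fin finP by simp
  have Q: "pmf Q x = (\<Sum>s\<in>set_pmf \<mu>. pmf \<mu> s * pmf (P s) x)" for x
    unfolding Q_def pmf_bind using fin
    by (subst integral_measure_pmf_real[of "set_pmf \<mu>"]) (auto simp: mult.commute)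
  have "pmf_entropy Q = (\<Sum>x\<in>set_pmf Q. \<Sum>s\<in>set_pmf \<mu>. pmf \<mu> s * (pmf (P s) x * ln (1 / pmf Q x)))"
    unfolding pmf_entropy_def by (subst Q) (simp add: sum_distrib_right mult.assoc)
  also have "\<dots> = (\<Sum>s\<in>set_pmf \<mu>. pmf \<mu> s * (\<Sum>x\<in>set_pmf Q. pmf (P s) x * ln (1 / pmf Q x)))"
    by (subst sum.swap) (simp add: sum_distrib_left)
  also have "\<dots> = (\<Sum>s\<in>set_pmf \<mu>. pmf \<mu> s * (\<Sum>x\<in>set_pmf (P s). pmf (P s) x * ln (1 / pmf Q x)))"
    using finQ setQ
    by (intro sum.cong refl arg_cong2[where f = "(*)"] sum.mono_neutral_right) (auto simp: set_pmf_eq)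
  finally have H: "pmf_entropy Q - (\<Sum>s\<in>set_pmf \<mu>. pmf \<mu> s * pmf_entropy (P s)) =
     (\<Sum>s\<in>set_pmf \<mu>. pmf \<mu> s *
      (\<Sum>x\<in>set_pmf (P s). pmf (P s) x * (ln (1 / pmf Q x) - ln (1 / pmf (P s) x))))"
    by (simp add: pmf_entropy_def sum_subtractf right_diff_distrib)
  have "(\<Sum>s\<in>set_pmf \<mu>. pmf \<mu> s *
      (measure_pmf.expectation (P s) f - measure_pmf.expectation Q f)\<^sup>2)
    \<le> (\<Sum>s\<in>set_pmf \<mu>. pmf \<mu> s * (4 * (\<Sum>x\<in>set_pmf (P s). pmf (P s) x * ln (pmf (P s) x / pmf Q x))))"
    using setQ by (intro sum_mono mult_left_mono expectation_diff_le_relative_entropy finQ f) auto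
  also have "\<dots> = 4 * (\<Sum>s\<in>set_pmf \<mu>. pmf \<mu> s *
      (\<Sum>x\<in>set_pmf (P s). pmf (P s) x * (ln (1 / pmf Q x) - ln (1 / pmf (P s) x))))"
  proof -
    have "ln (pmf (P s) x / pmf Q x) = ln (1 / pmf Q x) - ln (1 / pmf (P s) x)"
      if "s \<in> set_pmf \<mu>" "x \<in> set_pmf (P s)" for s x
    proof -
      have "pmf (P s) x > 0" "pmf Q x > 0" using that setQ by (auto intro!: pmf_positive)
      then show ?thesis by (simp add: ln_div)
    qed
    then show ?thesis
      unfolding sum_distrib_left by (intro sum.cong refl) (simp add: ac_simps)
  qed
  finally show ?thesis using H by (simp add: Q_def)
qed

section \<open>The entropy criterion\<close>

text \<open>For countable sets the product of the discrete sigma-algebras is again discrete, so any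
  \<open>h\<close> is measurable on it. This makes the position, a product of group elements,
  measurable.\<close>

lemma measurable_count_space_pair:
  assumes "countable A" "countable B" "f \<in> measurable M (count_space A)" "g \<in> measurable M (count_space B)"
    "\<And>a b. a \<in> A \<Longrightarrow> b \<in> B \<Longrightarrow> h a b \<in> space N"
  shows "(\<lambda>x. h (f x) (g x)) \<in> measurable M N"
proof -
  have "(\<lambda>x. (f x, g x)) \<in> measurable M (count_space A \<Otimes>\<^sub>M count_space B)"
    using assms by (intro measurable_Pair)
  moreover have "(\<lambda>(a, b). h a b) \<in> measurable (count_space A \<Otimes>\<^sub>M count_space B) N"
    unfolding pair_measure_countable[OF assms(1,2)] using assms(5) by auto
  ultimately show ?thesis by (auto dest: measurable_compose)
qed

section \<open>Path space of a random walk on a countable group\<close>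

locale countable_random_walk = group G for G :: "('a, 'b) monoid_scheme" (structure) +
  fixes \<mu> :: "'a pmf"
  assumes countable_carrier: "countable (carrier G)"
    and supp: "set_pmf \<mu> \<subseteq> carrier G"
    and finite_supp: "finite (set_pmf \<mu>)"
begin

definition step :: "'a measure" where
  "step = restrict_space (measure_pmf \<mu>) (carrier G)"

lemma space_step [simp]: "space step = carrier G"
  by (simp add: step_def space_restrict_space)

lemma sets_step [simp]: "sets step = Pow (carrier G)"
  by (auto simp: step_def sets_restrict_space)

lemma sets_step_count_space [measurable_cong]: "sets step = sets (count_space (carrier G))"
  by simp

lemma prob_space_step: "prob_space step"
  unfolding step_def using supp
  by (intro prob_space_restrict_space) (auto simp: AE_measure_pmf_iff intro!: measure_pmf.emeasure_eq_1_AE)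

sublocale incr: sequence_space step
  unfolding sequence_space_def by (rule product_prob_spaceI) (rule prob_space_step)

abbreviation "S \<equiv> incr.S"

lemma space_S: "space S = UNIV \<rightarrow> carrier G"
  by (auto simp: space_PiM)

lemma increment_prod_closed [simp]: "\<omega> \<in> space S \<Longrightarrow> increment_prod G \<omega> n \<in> carrier G"
  by (induction n) (auto simp: space_S)

text \<open>\<open>increment_prod\<close> grows at its right end, whereas first-step analysis
  removes the first factor on the left; associativity reconciles the two.\<close>

lemma increment_prod_case_nat:
  assumes "s \<in> carrier G" "\<omega> \<in> space S"
  shows "increment_prod G (case_nat s \<omega>) (Suc n) = s \<otimes> increment_prod G \<omega> n"
proof (induction n)
  case (Suc n)
  have "\<omega> n \<in> carrier G" using assms by (auto simp: space_S)
  then show ?case using Suc assms by (simp add: m_assoc)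
qed (use assms in simp)

lemma case_nat_in_space: "s \<in> carrier G \<Longrightarrow> \<omega> \<in> space S \<Longrightarrow> case_nat s \<omega> \<in> space S"
  by (auto simp: space_S Pi_iff split: nat.split)

lemma measurable_increment_prod [measurable]:
  "(\<lambda>\<omega>. increment_prod G \<omega> n) \<in> measurable S (count_space (carrier G))"
proof (induction n)
  case (Suc n)
  have "(\<lambda>\<omega>. \<omega> n) \<in> measurable S step" by simp
  then have "(\<lambda>\<omega>. \<omega> n) \<in> measurable S (count_space (carrier G))"
    by (simp add: measurable_cong_sets[OF refl sets_step_count_space])
  then show ?case
    unfolding increment_prod.simps
    by (rule measurable_count_space_pair[OF countable_carrier countable_carrier Suc]) simp
qed simp

lemma measurable_translated_path [measurable]:
  assumes "x \<in> carrier G"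
  shows "(\<lambda>\<omega> n. x \<otimes> increment_prod G \<omega> (Suc n)) \<in> measurable S (\<Pi>\<^sub>M i\<in>UNIV. count_space (carrier G))"
proof (rule measurable_PiM_single')
  fix n
  have "(\<lambda>y. x \<otimes> y) \<in> measurable (count_space (carrier G)) (count_space (carrier G))"
    using assms by auto
  then show "(\<lambda>\<omega>. x \<otimes> increment_prod G \<omega> (Suc n)) \<in> measurable S (count_space (carrier G))"
    by (rule measurable_compose[OF measurable_increment_prod])
qed (use assms in \<open>auto simp del: increment_prod.simps\<close>)

lemma walk_law_eq:
  "walk_law G \<mu> = distr S (\<Pi>\<^sub>M i\<in>UNIV. count_space (carrier G)) (\<lambda>\<omega> n. increment_prod G \<omega> (Suc n))"
  by (simp add: walk_law_def step_def)

lemma measurable_path [measurable]: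
  "(\<lambda>\<omega> n. increment_prod G \<omega> (Suc n)) \<in> measurable S (\<Pi>\<^sub>M i\<in>UNIV. count_space (carrier G))"
  by (rule measurable_PiM_single') (auto simp del: increment_prod.simps)

text \<open>Prepending an independent increment to an i.i.d. sequence gives an i.i.d. sequence
  again. This is the Markov property at time 1; iterated by induction it takes the place of
  conditional expectations.\<close>

lemma prob_first_step:
  assumes E: "E \<in> sets S"
  shows "measure S E = (\<Sum>s\<in>set_pmf \<mu>. pmf \<mu> s * measure S {\<omega> \<in> space S. case_nat s \<omega> \<in> E})"
proof -
  have m: "(\<lambda>(s, \<omega>). case_nat s \<omega>) \<in> measurable (step \<Otimes>\<^sub>M S) S"
    by measurable
  let ?E = "(\<lambda>(s, \<omega>). case_nat s \<omega>) -` E \<inter> space (step \<Otimes>\<^sub>M S)"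
  have sec: "Pair s -` ?E = {\<omega> \<in> space S. case_nat s \<omega> \<in> E}" if "s \<in> carrier G" for s
    using that by (auto simp: space_pair_measure)
  have "emeasure S E = emeasure (distr (step \<Otimes>\<^sub>M S) S (\<lambda>(s, \<omega>). case_nat s \<omega>)) E"
    by (simp add: incr.PiM_iter)
  also have "\<dots> = emeasure (step \<Otimes>\<^sub>M S) ?E"
    using m E by (rule emeasure_distr)
  also have "\<dots> = (\<integral>\<^sup>+s. emeasure S (Pair s -` ?E) \<partial>step)"
    using measurable_sets[OF m E] by (rule incr.P.emeasure_pair_measure_alt)
  also have "\<dots> = (\<integral>\<^sup>+s. emeasure S (Pair s -` ?E) * indicator (carrier G) s \<partial>\<mu>)"
    unfolding step_def by (rule nn_integral_restrict_space) simp
  also have "\<dots> = (\<Sum>s\<in>set_pmf \<mu>. emeasure S (Pair s -` ?E) * indicator (carrier G) s * pmf \<mu> s)"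
    by (rule nn_integral_measure_pmf_finite[OF finite_supp]) simp
  also have "\<dots> = (\<Sum>s\<in>set_pmf \<mu>. ennreal (pmf \<mu> s * measure S {\<omega> \<in> space S. case_nat s \<omega> \<in> E}))"
    using supp sec
    by (intro sum.cong refl)
      (auto simp: incr.P.emeasure_eq_measure ennreal_mult'' mult.commute subset_eq)
  also have "\<dots> = ennreal (\<Sum>s\<in>set_pmf \<mu>. pmf \<mu> s * measure S {\<omega> \<in> space S. case_nat s \<omega> \<in> E})"
    by (intro sum_ennreal) auto
  finally show ?thesis
    by (simp add: incr.P.emeasure_eq_measure sum_nonneg)
qed

section \<open>Entropy of the position and bounded harmonic functions\<close>

definition word_value :: "'a list \<Rightarrow> 'a" where
  "word_value l = foldr (\<otimes>) l \<one>"

text \<open>The position at time n read off from finite words, so that its entropy is a finite sum.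
  \<open>foldr\<close> puts the first letter on the left, and the recursion of
  \<open>replicate_pmf\<close> becomes a first-step decomposition.\<close>

definition walk_pmf :: "nat \<Rightarrow> 'a pmf" where
  "walk_pmf n = map_pmf word_value (replicate_pmf n \<mu>)"

lemma walk_pmf_0: "walk_pmf 0 = return_pmf \<one>"
  by (simp add: walk_pmf_def word_value_def)

lemma walk_pmf_Suc: "walk_pmf (Suc n) = bind_pmf \<mu> (\<lambda>s. map_pmf ((\<otimes>) s) (walk_pmf n))"
  by (simp add: walk_pmf_def map_bind_pmf map_pmf_comp bind_return_pmf word_value_def
      map_pmf_def[symmetric])

lemma word_value_closed: "l \<in> lists (set_pmf \<mu>) \<Longrightarrow> word_value l \<in> carrier G"
  using supp by (induction l) (auto simp: word_value_def)

lemma set_walk_pmf: "set_pmf (walk_pmf n) \<subseteq> carrier G"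
  using word_value_closed by (auto simp: walk_pmf_def set_replicate_pmf)

lemma finite_walk_pmf: "finite (set_pmf (walk_pmf n))"
  by (induction n) (auto simp: walk_pmf_0 walk_pmf_Suc finite_supp)

lemma inj_on_mult: "s \<in> carrier G \<Longrightarrow> A \<subseteq> carrier G \<Longrightarrow> inj_on ((\<otimes>) s) A"
  using inj_on_subset inj_on_cmult by blast

definition harmonic :: "('a \<Rightarrow> real) \<Rightarrow> bool" where
  "harmonic h \<longleftrightarrow> (\<forall>x\<in>carrier G. h x = (\<Sum>s\<in>set_pmf \<mu>. pmf \<mu> s * h (x \<otimes> s)))"

lemma harmonic_walk_pmf:
  assumes h: "harmonic h" and x: "x \<in> carrier G"
  shows "h x = measure_pmf.expectation (walk_pmf n) (\<lambda>y. h (x \<otimes> y))"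
  using x
proof (induction n arbitrary: x)
  case (Suc n)
  have "measure_pmf.expectation (walk_pmf (Suc n)) (\<lambda>y. h (x \<otimes> y)) =
    (\<Sum>s\<in>set_pmf \<mu>. pmf \<mu> s * measure_pmf.expectation (walk_pmf n) (\<lambda>y. h (x \<otimes> (s \<otimes> y))))"
    unfolding walk_pmf_Suc
    by (subst pmf_expectation_bind[OF finite_supp]) (auto simp: finite_walk_pmf)
  also have "\<dots> = (\<Sum>s\<in>set_pmf \<mu>. pmf \<mu> s * h (x \<otimes> s))"
  proof (intro sum.cong refl)
    fix s assume "s \<in> set_pmf \<mu>"
    then have s: "s \<in> carrier G" using supp by auto
    have "measure_pmf.expectation (walk_pmf n) (\<lambda>y. h (x \<otimes> (s \<otimes> y))) =
      measure_pmf.expectation (walk_pmf n) (\<lambda>y. h (x \<otimes> s \<otimes> y))"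
      using set_walk_pmf s Suc.prems
      by (intro integral_cong_AE) (auto simp: AE_measure_pmf_iff m_assoc subset_eq)
    also have "\<dots> = h (x \<otimes> s)" using Suc.IH[of "x \<otimes> s"] s Suc.prems by simp
    finally show "pmf \<mu> s * measure_pmf.expectation (walk_pmf n) (\<lambda>y. h (x \<otimes> (s \<otimes> y))) = pmf \<mu> s * h (x \<otimes> s)"
      by simp
  qed
  also have "\<dots> = h x" using h Suc.prems by (simp add: harmonic_def)
  finally show ?case ..
qed (simp add: walk_pmf_0)

text \<open>Given the first increment s, the position at time N + 1 is distributed as s times the
  position at time N, which has the same entropy because left multiplication is injective. The
  entropy gap of the mixture is therefore the increment from N to N + 1. By harmonicity the left
  side of each such bound is the same for every N, so the bounds telescope.\<close>

lemma harmonic_increment_le_entropy: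
  assumes h: "harmonic h" and bd: "\<And>x. \<bar>h x\<bar> \<le> 1" and x: "x \<in> carrier G"
  shows "real N * (\<Sum>s\<in>set_pmf \<mu>. pmf \<mu> s * (h (x \<otimes> s) - h x)\<^sup>2) \<le> 4 * pmf_entropy (walk_pmf N)"
proof (induction N)
  case 0
  show ?case by (simp add: pmf_entropy_nonneg)
next
  case (Suc N)
  let ?P = "\<lambda>s. map_pmf ((\<otimes>) s) (walk_pmf N)"
  have 1: "measure_pmf.expectation (?P s) (\<lambda>y. h (x \<otimes> y)) = h (x \<otimes> s)" if "s \<in> set_pmf \<mu>" for s
  proof -
    have s: "s \<in> carrier G" using that supp by auto
    have "measure_pmf.expectation (?P s) (\<lambda>y. h (x \<otimes> y)) =
      measure_pmf.expectation (walk_pmf N) (\<lambda>y. h (x \<otimes> (s \<otimes> y)))" by simp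
    also have "\<dots> = measure_pmf.expectation (walk_pmf N) (\<lambda>y. h (x \<otimes> s \<otimes> y))"
      using set_walk_pmf s x
      by (intro integral_cong_AE) (auto simp: AE_measure_pmf_iff m_assoc subset_eq)
    finally show ?thesis using harmonic_walk_pmf[OF h, of "x \<otimes> s" N] s x by simp
  qed
  have 2: "pmf_entropy (?P s) = pmf_entropy (walk_pmf N)" if "s \<in> set_pmf \<mu>" for s
    using that supp set_walk_pmf by (intro pmf_entropy_map_inj inj_on_mult) auto
  have "(\<Sum>s\<in>set_pmf \<mu>. pmf \<mu> s * (measure_pmf.expectation (?P s) (\<lambda>y. h (x \<otimes> y)) -
      measure_pmf.expectation (bind_pmf \<mu> ?P) (\<lambda>y. h (x \<otimes> y)))\<^sup>2)
    \<le> 4 * (pmf_entropy (bind_pmf \<mu> ?P) - (\<Sum>s\<in>set_pmf \<mu>. pmf \<mu> s * pmf_entropy (?P s)))"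
    by (intro expectation_diff_le_entropy_gap finite_supp bd) (simp add: finite_walk_pmf)
  also have "(\<Sum>s\<in>set_pmf \<mu>. pmf \<mu> s * pmf_entropy (?P s)) = pmf_entropy (walk_pmf N)"
    using 2 finite_supp by (simp add: sum_distrib_right[symmetric] sum_pmf_eq_1)
  finally have "(\<Sum>s\<in>set_pmf \<mu>. pmf \<mu> s * (h (x \<otimes> s) - h x)\<^sup>2)
    \<le> 4 * (pmf_entropy (walk_pmf (Suc N)) - pmf_entropy (walk_pmf N))"
    using 1 harmonic_walk_pmf[OF h x, of "Suc N"] by (simp add: walk_pmf_Suc)
  then show ?case using Suc by (simp add: algebra_simps)
qed

text \<open>The mean squared change of \<open>h\<close> does not depend on N, so one N with entropy
  at most (epsilon / 4) N bounds it by epsilon.\<close>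

lemma bounded_harmonic_step:
  assumes H: "\<And>\<epsilon>. \<epsilon> > 0 \<Longrightarrow> \<exists>N>0. pmf_entropy (walk_pmf N) \<le> \<epsilon> * real N"
    and h: "harmonic h" and bd: "\<And>x. \<bar>h x\<bar> \<le> 1" and x: "x \<in> carrier G" and s: "s \<in> set_pmf \<mu>"
  shows "h (x \<otimes> s) = h x"
proof -
  let ?D = "\<Sum>s\<in>set_pmf \<mu>. pmf \<mu> s * (h (x \<otimes> s) - h x)\<^sup>2"
  have "?D \<le> 0 + \<epsilon>" if \<epsilon>: "\<epsilon> > 0" for \<epsilon>
  proof -
    obtain N where N: "N > 0" "pmf_entropy (walk_pmf N) \<le> \<epsilon> / 4 * real N"
      using H[of "\<epsilon> / 4"] \<epsilon> by auto
    have "real N * ?D \<le> 4 * pmf_entropy (walk_pmf N)"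
      by (rule harmonic_increment_le_entropy[OF h bd x])
    also have "\<dots> \<le> real N * \<epsilon>" using N by (simp add: ac_simps)
    finally show ?thesis using N by simp
  qed
  then have "?D \<le> 0" by (rule field_le_epsilon)
  moreover have "pmf \<mu> s * (h (x \<otimes> s) - h x)\<^sup>2 \<le> ?D"
    using finite_supp s by (intro member_le_sum) auto
  ultimately have "pmf \<mu> s * (h (x \<otimes> s) - h x)\<^sup>2 \<le> 0" by simp
  then show ?thesis using pmf_positive[OF s]
    by (simp add: mult_le_0_iff)
qed

text \<open>The harmonic function is the probability that the walk started at x has its path in
  \<open>A\<close>. It is constant only along steps in the support of \<open>\<mu>\<close>, which
  need not generate the group; this still makes the event independent of every cylinder of
  increments, hence of itself.\<close>

theorem trivial_Poisson_boundary_if_entropy_sublinear: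
  assumes H: "\<And>\<epsilon>. \<epsilon> > 0 \<Longrightarrow> \<exists>N>0. pmf_entropy (walk_pmf N) \<le> \<epsilon> * real N"
  shows "trivial_Poisson_boundary G \<mu>"
  unfolding trivial_Poisson_boundary_def
proof
  fix A assume A: "A \<in> shift_invariant_events G \<mu>"
  let ?W = "\<Pi>\<^sub>M i\<in>(UNIV::nat set). count_space (carrier G)"
  have A_sets: "A \<in> sets ?W"
    and A_inv: "path_shift -` A \<inter> space ?W = A"
    using A by (auto simp: shift_invariant_events_def walk_law_eq)
  define B where "B x = {\<omega> \<in> space S. (\<lambda>n. x \<otimes> increment_prod G \<omega> (Suc n)) \<in> A}" for x
  have B_sets: "B x \<in> sets S" if "x \<in> carrier G" for x
  proof -
    have "B x = (\<lambda>\<omega> n. x \<otimes> increment_prod G \<omega> (Suc n)) -` A \<inter> space S"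
      by (auto simp: B_def)
    then show ?thesis using measurable_sets[OF measurable_translated_path[OF that] A_sets] by simp
  qed
  \<comment> \<open>Here exact shift invariance enters. Paths omit their starting point, so the
    entry that the shift drops, \<open>x \<otimes> s\<close>, is precisely the starting point of the
    remaining path.\<close>
  have B_shift: "case_nat s \<omega> \<in> B x \<longleftrightarrow> \<omega> \<in> B (x \<otimes> s)"
    if "x \<in> carrier G" "s \<in> carrier G" "\<omega> \<in> space S" for x s \<omega>
  proof -
    let ?p = "\<lambda>n. x \<otimes> increment_prod G (case_nat s \<omega>) (Suc n)"
    have "?p \<in> space ?W"
      using that increment_prod_closed[OF case_nat_in_space[OF that(2,3)]]
      by (auto simp: space_PiM simp del: increment_prod.simps)
    then have "?p \<in> A \<longleftrightarrow> path_shift ?p \<in> A" using A_inv by auto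
    moreover have "path_shift ?p = (\<lambda>n. x \<otimes> s \<otimes> increment_prod G \<omega> (Suc n))"
      using that increment_prod_closed[OF that(3)]
      by (auto simp: path_shift_def increment_prod_case_nat m_assoc simp del: increment_prod.simps)
    ultimately show ?thesis using that case_nat_in_space[OF that(2,3)]
      by (simp add: B_def del: increment_prod.simps)
  qed
  define h where "h x = measure S (B x)" for x
  have h: "harmonic h"
    unfolding harmonic_def
  proof
    fix x assume x: "x \<in> carrier G"
    have "{\<omega> \<in> space S. case_nat s \<omega> \<in> B x} = B (x \<otimes> s)" if "s \<in> set_pmf \<mu>" for s
      using B_shift[OF x] that supp by (auto simp: B_def)
    then show "h x = (\<Sum>s\<in>set_pmf \<mu>. pmf \<mu> s * h (x \<otimes> s))"
      unfolding h_def using prob_first_step[OF B_sets[OF x]] by simp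
  qed
  have step: "h (x \<otimes> s) = h x" if "x \<in> carrier G" "s \<in> set_pmf \<mu>" for x s
    using that by (intro bounded_harmonic_step[OF H h]) (auto simp: h_def)
  define cyl where "cyl n a = {\<omega> \<in> space S. \<forall>i<n. \<omega> i \<in> a i}" for n :: nat and a :: "nat \<Rightarrow> 'a set"
  have cyl_space: "cyl n a \<subseteq> space S" for n a by (auto simp: cyl_def)
  have cyl_sets: "cyl n a \<in> sets S" for n a
  proof -
    have "(\<lambda>\<omega>. \<omega> i) -` (a i \<inter> carrier G) \<inter> space S \<in> sets S" for i
      by (rule measurable_sets[OF measurable_component_singleton]) auto
    then have "{\<omega> \<in> space S. \<omega> i \<in> a i} \<in> sets S" for i
      by (rule back_subst) (auto simp: space_S)
    then have "{\<omega> \<in> space S. \<forall>i\<in>{..<n}. \<omega> i \<in> a i} \<in> sets S"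
      by (intro sets.sets_Collect_finite_All) auto
    also have "{\<omega> \<in> space S. \<forall>i\<in>{..<n}. \<omega> i \<in> a i} = cyl n a"
      by (auto simp: cyl_def)
    finally show ?thesis .
  qed
  \<comment> \<open>The start x is general because removing the first increment moves it to
    \<open>x \<otimes> s\<close>, where \<open>h\<close> has the same value.\<close>
  have indep: "measure S (B x \<inter> cyl n a) = h x * measure S (cyl n a)" if "x \<in> carrier G" for x n a
    using that
  proof (induction n arbitrary: x a)
    case 0
    have "B x \<inter> cyl 0 a = B x" "cyl 0 a = space S" by (auto simp: B_def cyl_def)
    then show ?case by (simp add: h_def incr.P.prob_space)
  next
    case (Suc n)
    have cyl_shift: "case_nat s \<omega> \<in> cyl (Suc n) a \<longleftrightarrow> s \<in> a 0 \<and> \<omega> \<in> cyl n (\<lambda>i. a (Suc i))"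
      if "s \<in> set_pmf \<mu>" "\<omega> \<in> space S" for s \<omega>
      using that supp case_nat_in_space[of s \<omega>] by (auto simp: cyl_def All_less_Suc2)
    have 1: "measure S {\<omega> \<in> space S. case_nat s \<omega> \<in> B x \<inter> cyl (Suc n) a} =
      indicator (a 0) s * (h x * measure S (cyl n (\<lambda>i. a (Suc i))))" if s: "s \<in> set_pmf \<mu>" for s
    proof -
      have "{\<omega> \<in> space S. case_nat s \<omega> \<in> B x \<inter> cyl (Suc n) a} =
        (if s \<in> a 0 then B (x \<otimes> s) \<inter> cyl n (\<lambda>i. a (Suc i)) else {})"
        using s supp B_shift[OF Suc.prems] cyl_shift[OF s] subsetD[OF cyl_space[of n]] by auto
      moreover have "x \<otimes> s \<in> carrier G" using s supp Suc.prems by auto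
      ultimately show ?thesis using Suc.IH[of "x \<otimes> s"] step[OF Suc.prems s] by simp
    qed
    have 2: "measure S {\<omega> \<in> space S. case_nat s \<omega> \<in> cyl (Suc n) a} =
      indicator (a 0) s * measure S (cyl n (\<lambda>i. a (Suc i)))" if s: "s \<in> set_pmf \<mu>" for s
    proof -
      have "{\<omega> \<in> space S. case_nat s \<omega> \<in> cyl (Suc n) a} =
        (if s \<in> a 0 then cyl n (\<lambda>i. a (Suc i)) else {})"
        using cyl_shift[OF s] subsetD[OF cyl_space[of n]] by auto
      then show ?thesis by simp
    qed
    have "measure S (B x \<inter> cyl (Suc n) a) =
      (\<Sum>s\<in>set_pmf \<mu>. pmf \<mu> s * (indicator (a 0) s * (h x * measure S (cyl n (\<lambda>i. a (Suc i))))))"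
      by (subst prob_first_step) (use 1 B_sets[OF Suc.prems] cyl_sets in auto)
    also have "\<dots> = h x * (\<Sum>s\<in>set_pmf \<mu>. pmf \<mu> s * (indicator (a 0) s * measure S (cyl n (\<lambda>i. a (Suc i)))))"
      by (simp add: sum_distrib_left ac_simps)
    also have "(\<Sum>s\<in>set_pmf \<mu>. pmf \<mu> s * (indicator (a 0) s * measure S (cyl n (\<lambda>i. a (Suc i))))) =
      measure S (cyl (Suc n) a)"
      by (subst prob_first_step[OF cyl_sets]) (use 2 in auto)
    finally show ?case .
  qed
  define p where "p = h \<one>"
  have B1: "B \<one> \<in> sets S" by (simp add: B_sets)
  \<comment> \<open>Kolmogorov's argument: the two measures agree on cylinders, hence everywhere,
    and evaluating both at \<open>B \<one>\<close> itself gives p = p * p.\<close>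
  have "density S (indicator (B \<one>)) = density S (\<lambda>_. ennreal p)"
  proof (rule measure_eqI_PiM_infinite)
    fix a :: "nat \<Rightarrow> 'a set" and J :: "nat set" assume J: "finite J" "\<And>i. i \<in> J \<Longrightarrow> a i \<in> sets step"
    obtain n where n: "\<And>i. i \<in> J \<Longrightarrow> i < n"
      using J(1) by (meson finite_nat_set_iff_bounded)
    \<comment> \<open>A cylinder over an arbitrary finite \<open>J\<close> becomes a condition on an
      initial segment, with no constraint on the coordinates outside \<open>J\<close>.\<close>
    define a' where "a' i = (if i \<in> J then a i else UNIV)" for i
    have eq: "prod_emb UNIV (\<lambda>_. step) J (Pi\<^sub>E J a) = cyl n a'"
      using n by (fastforce simp: prod_emb_iff cyl_def a'_def space_S restrict_def PiE_iff
          extensional_def)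
    have "emeasure (density S (indicator (B \<one>))) (cyl n a') = ennreal (measure S (B \<one> \<inter> cyl n a'))"
      using B1 cyl_sets
      by (simp add: emeasure_density indicator_inter_arith[symmetric] incr.P.emeasure_eq_measure sets.Int)
    also have "\<dots> = ennreal (p * measure S (cyl n a'))"
      by (simp add: indep p_def)
    also have "\<dots> = emeasure (density S (\<lambda>_. ennreal p)) (cyl n a')"
      using cyl_sets
      by (simp add: emeasure_density_const ennreal_mult'' incr.P.emeasure_eq_measure)
    finally show "emeasure (density S (indicator (B \<one>))) (prod_emb UNIV (\<lambda>_. step) J (Pi\<^sub>E J a))
      = emeasure (density S (\<lambda>_. ennreal p)) (prod_emb UNIV (\<lambda>_. step) J (Pi\<^sub>E J a))"
      by (simp add: eq)
  next
    show "finite_measure (density S (indicator (B \<one>)))"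
      by (rule finite_measureI) (use B1 in \<open>simp add: emeasure_density\<close>)
  qed simp_all
  then have "emeasure (density S (indicator (B \<one>))) (B \<one>) = emeasure (density S (\<lambda>_. ennreal p)) (B \<one>)"
    by simp
  then have "ennreal p = ennreal (p * p)"
    using B1 by (simp add: emeasure_density_const emeasure_density incr.P.emeasure_eq_measure
        indicator_inter_arith[symmetric] p_def h_def ennreal_mult'')
  then have "p = p * p" by (simp add: p_def h_def)
  then have "p = 0 \<or> p = 1" by simp
  moreover have "measure (walk_law G \<mu>) A = p"
  proof -
    have "measure (walk_law G \<mu>) A = measure S ((\<lambda>\<omega> n. increment_prod G \<omega> (Suc n)) -` A \<inter> space S)"
      unfolding walk_law_eq by (rule measure_distr[OF measurable_path A_sets])
    also have "(\<lambda>\<omega> n. increment_prod G \<omega> (Suc n)) -` A \<inter> space S = B \<one>"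
    proof -
      have "(\<lambda>n. \<one> \<otimes> increment_prod G \<omega> (Suc n)) = (\<lambda>n. increment_prod G \<omega> (Suc n))"
        if "\<omega> \<in> space S" for \<omega>
        using increment_prod_closed[OF that] by (auto simp del: increment_prod.simps)
      then show ?thesis by (auto simp: B_def)
    qed
    finally show ?thesis by (simp add: p_def h_def)
  qed
  ultimately show "measure (walk_law G \<mu>) A = 0 \<or> measure (walk_law G \<mu>) A = 1" by simp
qed

end

section \<open>The range of a recurrent walk\<close>

text \<open>The points visited by the walk from 0 with the listed steps, its start included.
  Recursion on the first step exhibits the later points as a translate of a shorter range.\<close>

primrec partial_sums :: "'a::monoid_add list \<Rightarrow> 'a set" where
  "partial_sums [] = {0}"
| "partial_sums (z # l) = insert 0 ((+) z ` partial_sums l)"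

lemma finite_partial_sums [simp]: "finite (partial_sums l)"
  by (induction l) auto

lemma zero_in_partial_sums [simp]: "0 \<in> partial_sums l"
  by (cases l) auto

lemma finite_set_replicate_pmf:
  "finite (set_pmf p) \<Longrightarrow> finite (set_pmf (replicate_pmf n p))"
  using finite_lists_length_eq[of "set_pmf p" n]
  by (simp add: set_replicate_pmf lists_eq_set Collect_conj_eq[symmetric] conj_commute)

lemma expectation_replicate_pmf_Suc:
  fixes f :: "'a list \<Rightarrow> real"
  assumes "finite (set_pmf p)"
  shows "measure_pmf.expectation (replicate_pmf (Suc n) p) f =
    (\<Sum>z\<in>set_pmf p. pmf p z * measure_pmf.expectation (replicate_pmf n p) (\<lambda>l. f (z # l)))"
  using finite_set_replicate_pmf[OF assms]
  by (simp add: pmf_expectation_bind[OF assms] map_pmf_def[symmetric])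

lemma prob_replicate_pmf_Suc:
  assumes "finite (set_pmf p)"
  shows "measure_pmf.prob (replicate_pmf (Suc n) p) X =
    (\<Sum>z\<in>set_pmf p. pmf p z * measure_pmf.prob (replicate_pmf n p) {l. z # l \<in> X})"
proof -
  have prob: "measure_pmf.prob q Y = measure_pmf.expectation q (indicator Y)" for q :: "'b pmf" and Y
    by simp
  have ind: "(\<lambda>l. indicator X (z # l)) = (indicator {l. z # l \<in> X} :: 'a list \<Rightarrow> real)" for z
    by (auto simp: indicator_def)
  show ?thesis
    unfolding prob expectation_replicate_pmf_Suc[OF assms] ind ..
qed

lemma mult_Z2: "x \<otimes>\<^bsub>Z2\<^esub> y = x + y"
  by (simp add: mult_DirProd' plus_prod_def)

lemma one_Z2: "\<one>\<^bsub>Z2\<^esub> = 0"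
  by (simp add: zero_prod_def)

lemma carrier_Z2: "carrier Z2 = UNIV"
  by simp

lemma group_Z2: "group Z2"
  by (simp add: DirProd_group)

lemma (in countable_random_walk) increment_prod_event:
  "{\<omega> \<in> space S. increment_prod G \<omega> n \<in> D} \<in> sets S"
proof -
  have "(\<lambda>\<omega>. increment_prod G \<omega> n) -` (D \<inter> carrier G) \<inter> space S \<in> sets S"
    by (rule measurable_sets[OF measurable_increment_prod]) auto
  also have "(\<lambda>\<omega>. increment_prod G \<omega> n) -` (D \<inter> carrier G) \<inter> space S =
    {\<omega> \<in> space S. increment_prod G \<omega> n \<in> D}" by auto
  finally show ?thesis .
qed

text \<open>By decomposition at the first step, the range with one more step is a translate of the
  old range together with 0, and 0 is new exactly when the walk never comes back to it. So the
  expected range grows by the probability of no return so far; recurrence sends this to 0, and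
  averaging gives the claim.\<close>

lemma expected_range_sublinear:
  fixes \<nu> :: "(int \<times> int) pmf"
  assumes fin: "finite (set_pmf \<nu>)" and rec: "recurrent_walk Z2 \<nu>" and \<epsilon>: "\<epsilon> > 0"
  shows "\<exists>n0. \<forall>n\<ge>n0. measure_pmf.expectation (replicate_pmf n \<nu>)
    (\<lambda>l. real (card (partial_sums l))) \<le> \<epsilon> * real n"
proof -
  interpret W: countable_random_walk Z2 \<nu>
    by (rule countable_random_walk.intro[OF group_Z2], unfold_locales) (auto intro: fin)
  have space: "\<omega> \<in> space W.S" for \<omega>
    by (simp add: W.space_S)
  define avoid where "avoid x n = {\<omega> \<in> space W.S. \<forall>i\<in>{..n}. x + increment_prod Z2 \<omega> i \<noteq> 0}"
    for x and n :: nat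
  have avoid_sets: "avoid x n \<in> sets W.S" for x n
  proof -
    have "{\<omega> \<in> space W.S. x + increment_prod Z2 \<omega> i \<noteq> 0} \<in> sets W.S" for i
      using W.increment_prod_event[of i "{y. x + y \<noteq> 0}"] by simp
    then show ?thesis unfolding avoid_def by (intro sets.sets_Collect_finite_All) auto
  qed
  have inc0: "increment_prod Z2 \<omega> 0 = 0" for \<omega> by (simp add: one_Z2 del: one_DirProd)
  have inc_case: "increment_prod Z2 (case_nat z \<omega>) (Suc i) = z + increment_prod Z2 \<omega> i" for z \<omega> i
    using W.increment_prod_case_nat[OF _ space, of z \<omega> i] by (simp only: mult_Z2 carrier_Z2 UNIV_I)
  \<comment> \<open>This carries hitting probabilities from finite lists, where the range is
    counted, to the sequence space, where recurrence is stated.\<close>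
  have avoid: "measure_pmf.prob (replicate_pmf n \<nu>) {l. 0 \<notin> (+) x ` partial_sums l} =
    measure W.S (avoid x n)" for x n
  proof (induction n arbitrary: x)
    case 0
    have "avoid x 0 = (if x = 0 then {} else space W.S)"
      using inc0 by (auto simp: avoid_def simp del: increment_prod.simps)
    then show ?case by (auto simp: W.incr.P.prob_space measure_return_pmf)
  next
    case (Suc n)
    have 1: "{l. z # l \<in> {l. 0 \<notin> (+) x ` partial_sums l}} =
      (if x = 0 then {} else {l. 0 \<notin> (+) (x + z) ` partial_sums l})" for z
      by (auto simp: image_iff add.assoc)
    have "(\<forall>i\<in>{..Suc n}. P i) \<longleftrightarrow> P 0 \<and> (\<forall>i\<in>{..n}. P (Suc i))" for P
      unfolding atMost_Suc_eq_insert_0 by auto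
    then have 2: "{\<omega> \<in> space W.S. case_nat z \<omega> \<in> avoid x (Suc n)} = (if x = 0 then {} else avoid (x + z) n)" for z
      using space inc0
      by (auto simp: avoid_def inc_case add.assoc simp del: increment_prod.simps)
    show ?case
      unfolding prob_replicate_pmf_Suc[OF fin] W.prob_first_step[OF avoid_sets] 1 2
      by (cases "x = 0") (simp_all only: if_True if_False Suc.IH measure_empty simp_thms)
  qed
  \<comment> \<open>The event that there is no return to 0 at any of the times 1 to n + 1.\<close>
  define ret where "ret n = {\<omega> \<in> space W.S. \<forall>i\<in>{..n}. increment_prod Z2 \<omega> (Suc i) \<noteq> 0}" for n :: nat
  have ret_sets: "ret n \<in> sets W.S" for n
    unfolding ret_def using W.increment_prod_event[of "Suc _" "{y. y \<noteq> 0}"]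
    by (intro sets.sets_Collect_finite_All) (auto simp del: increment_prod.simps)
  define E where "E n = measure_pmf.expectation (replicate_pmf n \<nu>)
    (\<lambda>l. real (card (partial_sums l)))" for n
  have E_Suc: "E (Suc n) = E n + measure W.S (ret n)" for n
  proof -
    have "card (partial_sums (z # l)) =
      card (partial_sums l) + (if 0 \<notin> (+) z ` partial_sums l then 1 else 0)" for z :: "int \<times> int" and l
      by (auto simp: card_insert_if card_image)
    then have "real (card (partial_sums (z # l))) =
      real (card (partial_sums l)) + indicator {l. 0 \<notin> (+) z ` partial_sums l} l" for z :: "int \<times> int" and l
      by (auto simp: indicator_def)
    then have "E (Suc n) = (\<Sum>z\<in>set_pmf \<nu>. pmf \<nu> z * (E n + measure W.S (avoid z n)))"
      unfolding E_def expectation_replicate_pmf_Suc[OF fin]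
      using finite_set_replicate_pmf[OF fin]
      by (simp add: avoid[symmetric] Bochner_Integration.integral_add integrable_measure_pmf_finite
          del: partial_sums.simps)
    also have "\<dots> = E n + (\<Sum>z\<in>set_pmf \<nu>. pmf \<nu> z * measure W.S (avoid z n))"
      using fin by (simp add: distrib_left sum.distrib sum_distrib_right[symmetric] sum_pmf_eq_1)
    also have "(\<Sum>z\<in>set_pmf \<nu>. pmf \<nu> z * measure W.S (avoid z n)) = measure W.S (ret n)"
    proof -
      have "{\<omega> \<in> space W.S. case_nat z \<omega> \<in> ret n} = avoid z n" for z
        using space by (auto simp: ret_def avoid_def inc_case simp del: increment_prod.simps)
      then show ?thesis by (simp add: W.prob_first_step[OF ret_sets])
    qed
    finally show ?thesis .
  qed
  have ret_lim: "(\<lambda>n. measure W.S (ret n)) \<longlonglongrightarrow> 0"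
  proof -
    have "decseq ret" by (auto simp: decseq_def ret_def)
    then have "(\<lambda>n. measure W.S (ret n)) \<longlonglongrightarrow> measure W.S (\<Inter>n. ret n)"
      using ret_sets by (intro W.incr.P.finite_Lim_measure_decseq) auto
    moreover have "AE \<omega> in W.S. \<exists>\<^sub>\<infinity>n. increment_prod Z2 \<omega> (Suc n) = 0"
      using rec unfolding recurrent_walk_def W.walk_law_eq one_Z2
      by (rule AE_distrD[OF W.measurable_path])
    then have "AE \<omega> in W.S. \<omega> \<notin> (\<Inter>n. ret n)"
      by (rule AE_mp) (auto simp: ret_def simp del: increment_prod.simps dest!: INFM_EX intro!: AE_I2)
    then have "measure W.S (\<Inter>n. ret n) = 0"
      using ret_sets by (subst W.incr.P.prob_eq_0) auto
    ultimately show ?thesis by simp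
  qed
  then have "\<forall>\<^sub>F n in sequentially. measure W.S (ret n) < \<epsilon> / 2"
    using \<epsilon> by (intro order_tendstoD) auto
  then obtain k where k: "\<And>n. n \<ge> k \<Longrightarrow> measure W.S (ret n) < \<epsilon> / 2"
    by (auto simp: eventually_sequentially)
  \<comment> \<open>The summand 1 is the starting point; each of the first k steps adds at most 1,
    each later one at most \<open>\<epsilon> / 2\<close>. The remaining half of
    \<open>\<epsilon>\<close> absorbs 1 + k for large n.\<close>
  have E_le: "E n \<le> 1 + real (min n k) + \<epsilon> / 2 * real n" for n
  proof (induction n)
    case 0
    show ?case by (simp add: E_def)
  next
    case (Suc n)
    have "measure W.S (ret n) \<le> real (min (Suc n) k) - real (min n k) + \<epsilon> / 2"
      using k[of n] \<epsilon>
      by (cases "n < k") (auto simp: min_def intro: order_trans[OF W.incr.P.prob_le_1])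
    moreover have "\<epsilon> / 2 * real (Suc n) = \<epsilon> / 2 * real n + \<epsilon> / 2"
      by (simp add: algebra_simps)
    ultimately show ?case using Suc unfolding E_Suc by linarith
  qed
  obtain n0 :: nat where n0: "real n0 \<ge> (1 + real k) / (\<epsilon> / 2)"
    using real_arch_simple by blast
  show ?thesis
  proof (intro exI allI impI)
    fix n assume n: "n \<ge> n0"
    have "1 + real k \<le> real n0 * (\<epsilon> / 2)"
      using n0 \<epsilon> by (subst (asm) pos_divide_le_eq) auto
    also have "\<dots> \<le> \<epsilon> / 2 * real n" using n \<epsilon> by simp
    finally have "E n \<le> \<epsilon> * real n"
      using E_le[of n] by (simp add: min_def split: if_splits)
    then show "measure_pmf.expectation (replicate_pmf n \<nu>) (\<lambda>l. real (card (partial_sums l))) \<le> \<epsilon> * real n"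
      by (simp add: E_def)
  qed
qed

section \<open>Counting ranges and permutations of small displacement\<close>

lemma partial_sums_append:
  fixes l :: "'a::ab_group_add list"
  shows "partial_sums (l @ l') = partial_sums l \<union> (+) (sum_list l) ` partial_sums l'"
  by (induction l) (auto simp: image_iff add.assoc)

lemma sum_list_in_partial_sums: "sum_list l \<in> partial_sums l"
  by (induction l) auto

lemma partial_sums_prefix:
  "x \<in> partial_sums l \<Longrightarrow> \<exists>l1 l2. l = l1 @ l2 \<and> sum_list l1 = x"
proof (induction l arbitrary: x)
  case (Cons z l)
  show ?case
  proof (cases "x = 0")
    case True
    then show ?thesis by (intro exI[of _ "[]"] exI[of _ "z # l"]) auto
  next
    case False
    then obtain y where "y \<in> partial_sums l" "x = z + y" using Cons.prems by auto
    with Cons.IH[of y] obtain l1 l2 where "l = l1 @ l2" "x = z + sum_list l1" by auto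
    then show ?thesis by (intro exI[of _ "z # l1"] exI[of _ l2]) auto
  qed
qed auto

text \<open>Every new point is reached by inserting a detour back and forth into a tour of the old points.\<close>

lemma partial_sums_short_tour:
  fixes Z :: "'a::ab_group_add set"
  assumes "set l \<subseteq> Z"
  shows "\<exists>w. set w \<subseteq> Z \<union> uminus ` Z \<and> length w < 2 * card (partial_sums l) \<and> partial_sums w = partial_sums l"
  using assms
proof (induction l rule: rev_induct)
  case Nil
  show ?case by (intro exI[of _ "[]"]) auto
next
  case (snoc z l)
  then obtain w where w: "set w \<subseteq> Z \<union> uminus ` Z" "length w < 2 * card (partial_sums l)"
    "partial_sums w = partial_sums l" by auto
  let ?x = "sum_list l"
  have new: "partial_sums (l @ [z]) = insert (?x + z) (partial_sums l)"
    using sum_list_in_partial_sums[of l] by (auto simp: partial_sums_append)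
  show ?case
  proof (cases "?x + z \<in> partial_sums l")
    case True
    then show ?thesis using w new by (auto simp: insert_absorb)
  next
    case False
    obtain w1 w2 where w12: "w = w1 @ w2" "sum_list w1 = ?x"
      using partial_sums_prefix[of ?x w] sum_list_in_partial_sums[of l] w(3) by auto
    have "partial_sums (w1 @ [z, - z] @ w2) = insert (?x + z) (partial_sums w)"
      by (auto simp: partial_sums_append w12 image_image)
    then show ?thesis
      using False w w12 new snoc.prems
      by (intro exI[of _ "w1 @ [z, - z] @ w2"]) auto
  qed
qed

lemma card_lists_le:
  assumes "finite A"
  shows "card {xs. set xs \<subseteq> A \<and> length xs \<le> n} \<le> (card A + 1) ^ n"
proof -
  have "(\<Sum>i\<le>n. k ^ i) \<le> (k + 1) ^ n" for k :: nat
  proof (induction n)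
    case (Suc n)
    have "k ^ n \<le> (k + 1) ^ n" by (rule power_mono) auto
    then have "k * k ^ n \<le> k * (k + 1) ^ n" by (rule mult_left_mono) auto
    moreover have "(\<Sum>i\<le>Suc n. k ^ i) = (\<Sum>i\<le>n. k ^ i) + k * k ^ n" by simp
    moreover have "(k + 1) ^ Suc n = (k + 1) ^ n + k * (k + 1) ^ n" by simp
    ultimately show ?case using Suc by linarith
  qed simp
  then show ?thesis by (simp add: card_lists_length_le[OF assms])
qed

text \<open>The lists behind the ranges have unbounded length, so they cannot be counted themselves.
  A short tour determines the same range and has at most 2m letters from Z and -Z.\<close>

lemma card_ranges_le:
  fixes Z :: "'a::ab_group_add set" and m :: nat
  assumes Z: "finite Z"
  defines "R \<equiv> {U. card U \<le> m \<and> (\<exists>l. set l \<subseteq> Z \<and> partial_sums l = U)}"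
  shows "finite R" "card R \<le> (2 * card Z + 1) ^ (2 * m)"
proof -
  let ?Z = "Z \<union> uminus ` Z"
  let ?W = "{w. set w \<subseteq> ?Z \<and> length w \<le> 2 * m}"
  have sub: "R \<subseteq> partial_sums ` ?W"
  proof
    fix U assume "U \<in> R"
    then obtain l where l: "set l \<subseteq> Z" "partial_sums l = U" "card U \<le> m" by (auto simp: R_def)
    from partial_sums_short_tour[OF l(1)] obtain w where
      "set w \<subseteq> ?Z" "length w < 2 * card U" "partial_sums w = U" using l(2) by auto
    then show "U \<in> partial_sums ` ?W" using l(3) by (intro image_eqI[of _ _ w]) auto
  qed
  have fin: "finite ?W" using Z by (intro finite_lists_length_le) auto
  show "finite R" using sub fin by (meson finite_surj)
  have "card R \<le> card ?W" using fin sub by (meson surj_card_le)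
  also have "\<dots> \<le> (card ?Z + 1) ^ (2 * m)" using Z by (intro card_lists_le) auto
  also have "\<dots> \<le> (2 * card Z + 1) ^ (2 * m)"
  proof -
    have "card ?Z \<le> 2 * card Z"
      using card_Un_le[of Z "uminus ` Z"] card_image_le[OF Z, of uminus] by linarith
    then show ?thesis by (intro power_mono) auto
  qed
  finally show "card R \<le> (2 * card Z + 1) ^ (2 * m)" .
qed

section \<open>The generating function of the displacement vectors\<close>

definition norm1 :: "int \<times> int \<Rightarrow> nat" where
  "norm1 v = nat \<bar>fst v\<bar> + nat \<bar>snd v\<bar>"

lemma norm1_triangle: "norm1 (v + w) \<le> norm1 v + norm1 w"
proof -
  have "nat \<bar>a + b\<bar> \<le> nat \<bar>a\<bar> + nat \<bar>b\<bar>" for a b :: int by linarith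
  from add_mono[OF this this] show ?thesis by (simp add: norm1_def algebra_simps)
qed

lemma norm1_0 [simp]: "norm1 0 = 0"
  by (simp add: norm1_def)

lemma sum_power_abs_le:
  fixes a :: real
  assumes a: "0 < a" "a < 1" and V: "finite V"
  shows "(\<Sum>u\<in>V. a ^ nat \<bar>u\<bar>) \<le> 2 / (1 - a)"
proof -
  obtain n where n: "\<And>u. u \<in> V \<Longrightarrow> nat \<bar>u\<bar> < n"
    using V finite_nat_set_iff_bounded[of "(\<lambda>u. nat \<bar>u\<bar>) ` V"] by auto
  have geo: "(\<Sum>i<n. a ^ i) \<le> 1 / (1 - a)"
    using a by (simp add: sum_gp_strict divide_right_mono)
  have "V \<subseteq> int ` {..<n} \<union> (\<lambda>i. - int i) ` {..<n}"
  proof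
    fix u assume "u \<in> V"
    then have "nat \<bar>u\<bar> < n" using n by simp
    moreover have "u = int (nat \<bar>u\<bar>) \<or> u = - int (nat \<bar>u\<bar>)" by auto
    ultimately show "u \<in> int ` {..<n} \<union> (\<lambda>i. - int i) ` {..<n}" by blast
  qed
  then have "(\<Sum>u\<in>V. a ^ nat \<bar>u\<bar>) \<le> (\<Sum>u\<in>int ` {..<n} \<union> (\<lambda>i. - int i) ` {..<n}. a ^ nat \<bar>u\<bar>)"
    using a by (intro sum_mono2) auto
  also have "\<dots> \<le> (\<Sum>u\<in>int ` {..<n}. a ^ nat \<bar>u\<bar>) + (\<Sum>u\<in>(\<lambda>i. - int i) ` {..<n}. a ^ nat \<bar>u\<bar>)"
    using a by (subst sum_Un) (auto intro!: sum_nonneg)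
  also have "\<dots> = (\<Sum>i<n. a ^ i) + (\<Sum>i<n. a ^ i)"
    by (simp add: sum.reindex inj_on_def)
  also have "\<dots> \<le> 2 / (1 - a)" using geo by (simp add: add_divide_distrib[symmetric])
  finally show ?thesis .
qed

lemma sum_power_norm1_le:
  fixes a :: real
  assumes a: "0 < a" "a < 1" and V: "finite V"
  shows "(\<Sum>v\<in>V. a ^ norm1 v) \<le> (2 / (1 - a))\<^sup>2"
proof -
  have "(\<Sum>v\<in>V. a ^ norm1 v) \<le> (\<Sum>v\<in>fst ` V \<times> snd ` V. a ^ norm1 v)"
    using a V by (intro sum_mono2 subset_fst_snd) auto
  also have "\<dots> = (\<Sum>u\<in>fst ` V. a ^ nat \<bar>u\<bar>) * (\<Sum>u\<in>snd ` V. a ^ nat \<bar>u\<bar>)"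
    by (simp add: norm1_def power_add sum_product sum.cartesian_product case_prod_beta)
  also have "\<dots> \<le> (2 / (1 - a)) * (2 / (1 - a))"
    using a V by (intro mult_mono sum_power_abs_le sum_nonneg) auto
  finally show ?thesis by (simp add: power2_eq_square)
qed

text \<open>Exponential Markov inequality: each counted \<open>v\<close> has weight at least \<open>a ^ L\<close>.\<close>

lemma card_bounded_total_norm_le:
  fixes a :: real and U :: "'a set" and L :: nat
  assumes a: "0 < a" "a < 1" and U: "finite U"
  defines "F \<equiv> {v. v \<in> extensional U \<and> (\<Sum>y\<in>U. norm1 (v y)) \<le> L}"
  shows "finite F" "real (card F) * a ^ L \<le> (2 / (1 - a)) ^ (2 * card U)"
proof -
  \<comment> \<open>A finite box containing all values of the counted families, so that the sum over
    families of products factors into a product of finite sums.\<close>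
  define Q where "Q = {- int L..int L} \<times> {- int L..int L}"
  have sub: "F \<subseteq> PiE U (\<lambda>_. Q)"
  proof
    fix v assume v: "v \<in> F"
    have "v y \<in> Q" if y: "y \<in> U" for y
    proof -
      have "norm1 (v y) \<le> (\<Sum>y\<in>U. norm1 (v y))" using U y by (intro member_le_sum) auto
      then have "norm1 (v y) \<le> L" using v by (simp add: F_def)
      then show ?thesis by (cases "v y") (auto simp: norm1_def Q_def)
    qed
    then show "v \<in> PiE U (\<lambda>_. Q)" using v by (auto simp: F_def PiE_def)
  qed
  have finE: "finite (PiE U (\<lambda>_. Q))" using U by (intro finite_PiE) (auto simp: Q_def)
  show "finite F" using sub finE by (rule finite_subset)
  have "real (card F) * a ^ L = (\<Sum>v\<in>F. a ^ L)" by simp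
  also have "\<dots> \<le> (\<Sum>v\<in>F. \<Prod>y\<in>U. a ^ norm1 (v y))"
    using a by (intro sum_mono) (auto simp: F_def power_sum[symmetric] intro!: power_decreasing)
  also have "\<dots> \<le> (\<Sum>v\<in>PiE U (\<lambda>_. Q). \<Prod>y\<in>U. a ^ norm1 (v y))"
    using a sub finE by (intro sum_mono2) (auto intro!: prod_nonneg)
  also have "\<dots> = (\<Prod>y\<in>U. \<Sum>v\<in>Q. a ^ norm1 v)"
    using U by (intro prod_sum_PiE[symmetric]) (auto simp: Q_def)
  also have "\<dots> \<le> (\<Prod>y\<in>U. (2 / (1 - a))\<^sup>2)"
    using a by (intro prod_mono) (auto simp: Q_def intro!: sum_nonneg sum_power_norm1_le)
  also have "\<dots> = (2 / (1 - a)) ^ (2 * card U)"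
    by (simp add: power_mult)
  finally show "real (card F) * a ^ L \<le> (2 / (1 - a)) ^ (2 * card U)" .
qed

section \<open>Total displacement of a permutation\<close>

definition moved :: "('a \<Rightarrow> 'a) \<Rightarrow> 'a set" where
  "moved f = {x. f x \<noteq> x}"

definition displacement :: "(int \<times> int \<Rightarrow> int \<times> int) \<Rightarrow> nat" where
  "displacement f = (\<Sum>y\<in>moved f. norm1 (f y - y))"

lemma displacement_superset:
  assumes "finite U" "moved f \<subseteq> U"
  shows "(\<Sum>y\<in>U. norm1 (f y - y)) = displacement f"
  unfolding displacement_def using assms
  by (intro sum.mono_neutral_right) (auto simp: moved_def)

lemma moved_comp: "moved (f \<circ> g) \<subseteq> moved f \<union> moved g"
  by (auto simp: moved_def)

text \<open>The triangle inequality through \<open>g y\<close>, summed over y; injectivity of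
  \<open>g\<close> turns the first sum into one over the points \<open>g y\<close>.\<close>

lemma displacement_comp_le:
  assumes f: "finite (moved f)" and g: "finite (moved g)" "bij g"
  shows "displacement (f \<circ> g) \<le> displacement f + displacement g"
proof -
  let ?U = "moved f \<union> moved g"
  have "displacement (f \<circ> g) = (\<Sum>y\<in>?U. norm1 (f (g y) - y))"
    using displacement_superset[of ?U "f \<circ> g"] f g moved_comp[of f g] by simp
  also have "\<dots> \<le> (\<Sum>y\<in>?U. norm1 (f (g y) - g y) + norm1 (g y - y))"
  proof (rule sum_mono)
    fix y
    have "f (g y) - y = (f (g y) - g y) + (g y - y)" by simp
    then show "norm1 (f (g y) - y) \<le> norm1 (f (g y) - g y) + norm1 (g y - y)"
      by (metis norm1_triangle)
  qed
  also have "\<dots> = (\<Sum>y\<in>g ` ?U. norm1 (f y - y)) + (\<Sum>y\<in>?U. norm1 (g y - y))"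
    using bij_is_inj[OF g(2)] by (simp add: sum.distrib sum.reindex inj_on_subset[OF _ subset_UNIV])
  also have "(\<Sum>y\<in>g ` ?U. norm1 (f y - y)) = displacement f"
  proof (rule displacement_superset)
    \<comment> \<open>A permutation preserves its set of moved points, and a point fixed by
      \<open>g\<close> is its own image; so the reindexed sum still covers all points moved by
      \<open>f\<close>.\<close>
    have "g ` moved g = moved g"
      using g(2) unfolding moved_def bij_def inj_def surj_def by (auto simp: image_iff) (metis+)
    moreover have "y \<in> g ` moved f" if "y \<in> moved f" "y \<notin> moved g" for y
      using that by (auto simp: moved_def intro: image_eqI[of _ _ y])
    ultimately show "moved f \<subseteq> g ` ?U" by (auto simp: image_Un)
  qed (use f g in auto)
  also have "(\<Sum>y\<in>?U. norm1 (g y - y)) = displacement g"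
    using f g by (intro displacement_superset) auto
  finally show ?thesis .
qed

lemma moved_translate: "moved (translate z g) = (+) z ` moved g"
proof -
  have "y \<in> moved (translate z g) \<longleftrightarrow> y - z \<in> moved g" for y
    by (auto simp: moved_def translate_def algebra_simps)
  then show ?thesis by (force simp: image_iff)
qed

lemma displacement_translate: "displacement (translate z g) = displacement g"
  unfolding displacement_def moved_translate
  by (subst sum.reindex) (auto simp: translate_def inj_on_def algebra_simps)

section \<open>The shuffler group\<close>

lemma replicate_pmf_map: "replicate_pmf n (map_pmf f p) = map_pmf (map f) (replicate_pmf n p)"
  by (induction n) (simp_all add: map_bind_pmf bind_map_pmf)

lemma carrier_Shuffler: "carrier Shuffler_Z2 = {f. bij f \<and> finite (moved f)} \<times> UNIV"
  by (simp add: Shuffler_Z2_def FSym_Z2_def moved_def)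

lemma mult_Shuffler: "(f, x) \<otimes>\<^bsub>Shuffler_Z2\<^esub> (g, y) = (f \<circ> translate x g, x + y)"
  by (simp add: Shuffler_Z2_def FSym_Z2_def plus_prod_def mult_DirProd')

lemma one_Shuffler: "\<one>\<^bsub>Shuffler_Z2\<^esub> = (id, 0)"
  by (simp add: Shuffler_Z2_def FSym_Z2_def zero_prod_def)

lemma translate_eq_conj: "translate z g = (+) z \<circ> g \<circ> (+) (- z)"
  by (simp add: translate_def fun_eq_iff)

lemma translate_comp: "translate z (f \<circ> g) = translate z f \<circ> translate z g"
  by (simp add: translate_def fun_eq_iff)

lemma translate_translate: "translate z (translate w g) = translate (z + w) g"
  by (simp add: translate_def fun_eq_iff algebra_simps)

lemma translate_0 [simp]: "translate 0 g = g"
  by (simp add: translate_def fun_eq_iff)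

lemma translate_id [simp]: "translate z id = id"
  by (simp add: translate_def fun_eq_iff)

lemma bij_translate: "bij g \<Longrightarrow> bij (translate z g)"
  unfolding translate_eq_conj
  by (intro bij_comp) (simp_all add: bij_def)

lemma group_Shuffler: "group Shuffler_Z2"
proof (rule groupI)
  fix p q assume p: "p \<in> carrier Shuffler_Z2" and q: "q \<in> carrier Shuffler_Z2"
  obtain f x g y where pq: "p = (f, x)" "q = (g, y)" by (cases p, cases q)
  have "finite (moved (f \<circ> translate x g))"
    using p q by (intro finite_subset[OF moved_comp]) (auto simp: carrier_Shuffler moved_translate pq)
  then show "p \<otimes>\<^bsub>Shuffler_Z2\<^esub> q \<in> carrier Shuffler_Z2"
    using p q by (simp add: pq mult_Shuffler carrier_Shuffler bij_translate bij_comp)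
next
  show "\<one>\<^bsub>Shuffler_Z2\<^esub> \<in> carrier Shuffler_Z2"
    by (simp add: one_Shuffler carrier_Shuffler moved_def)
next
  fix p q r assume "p \<in> carrier Shuffler_Z2" "q \<in> carrier Shuffler_Z2" "r \<in> carrier Shuffler_Z2"
  show "p \<otimes>\<^bsub>Shuffler_Z2\<^esub> q \<otimes>\<^bsub>Shuffler_Z2\<^esub> r = p \<otimes>\<^bsub>Shuffler_Z2\<^esub> (q \<otimes>\<^bsub>Shuffler_Z2\<^esub> r)"
    by (cases p, cases q, cases r)
      (simp add: mult_Shuffler translate_comp translate_translate comp_assoc add.assoc)
next
  fix p assume p: "p \<in> carrier Shuffler_Z2"
  obtain f x where pf: "p = (f, x)" by (cases p)
  show "\<one>\<^bsub>Shuffler_Z2\<^esub> \<otimes>\<^bsub>Shuffler_Z2\<^esub> p = p"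
    by (simp add: pf one_Shuffler mult_Shuffler)
  have f: "bij f" "finite (moved f)" using p by (auto simp: pf carrier_Shuffler)
  have "moved (inv_into UNIV f) = moved f"
    using f(1) by (auto simp: moved_def bij_inv_eq_iff) (metis bij_inv_eq_iff)+
  then have "(translate (- x) (inv_into UNIV f), - x) \<in> carrier Shuffler_Z2"
    using f by (simp add: carrier_Shuffler bij_translate bij_imp_bij_inv moved_translate)
  moreover have "(translate (- x) (inv_into UNIV f), - x) \<otimes>\<^bsub>Shuffler_Z2\<^esub> p = \<one>\<^bsub>Shuffler_Z2\<^esub>"
    using f(1) by (simp add: pf mult_Shuffler one_Shuffler translate_comp[symmetric] bij_is_inj)
  ultimately show "\<exists>q\<in>carrier Shuffler_Z2. q \<otimes>\<^bsub>Shuffler_Z2\<^esub> p = \<one>\<^bsub>Shuffler_Z2\<^esub>" by blast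
qed

text \<open>A finitely supported map is determined by its graph over the moved points, a finite
  subset of a countable set.\<close>

lemma countable_carrier_Shuffler: "countable (carrier Shuffler_Z2)"
proof -
  let ?graph = "\<lambda>f :: int \<times> int \<Rightarrow> int \<times> int. (\<lambda>y. (y, f y)) ` moved f"
  let ?A = "{f :: int \<times> int \<Rightarrow> int \<times> int. finite (moved f)}"
  have "inj_on ?graph ?A"
  proof (rule inj_onI)
    fix f g assume eq: "?graph f = ?graph g"
    have "f y = g y" for y
    proof (cases "y \<in> moved f \<or> y \<in> moved g")
      case True
      then have "(y, f y) \<in> ?graph f \<or> (y, g y) \<in> ?graph g" by auto
      then have "(y, f y) \<in> ?graph g \<or> (y, g y) \<in> ?graph f" using eq by auto
      then show ?thesis by auto
    qed (simp add: moved_def)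
    then show "f = g" by auto
  qed
  moreover have "countable (?graph ` ?A)"
    by (rule countable_subset[OF _ countable_Collect_finite]) auto
  ultimately have "countable ?A" by (rule countable_image_inj_on[rotated])
  then show ?thesis
    unfolding carrier_Shuffler by (intro countable_SIGMA) (auto elim: countable_subset[rotated])
qed

section \<open>Counting group elements reached with few visited points\<close>

definition sumset :: "'a::plus set \<Rightarrow> 'a set \<Rightarrow> 'a set" where
  "sumset A B = (\<lambda>(a, b). a + b) ` (A \<times> B)"

lemma finite_sumset: "finite A \<Longrightarrow> finite B \<Longrightarrow> finite (sumset A B)"
  by (simp add: sumset_def)

lemma card_sumset_le: "finite A \<Longrightarrow> finite B \<Longrightarrow> card (sumset A B) \<le> card A * card B"
  unfolding sumset_def using card_image_le[of "A \<times> B" "\<lambda>(a, b). a + b"]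
  by (simp add: card_cartesian_product)

text \<open>A map fixing everything outside \<open>U\<close> is encoded injectively by its
  displacement vectors on \<open>U\<close>.\<close>

lemma card_small_displacement_le:
  fixes a :: real and L :: nat
  assumes a: "0 < a" "a < 1" and U: "finite U"
  defines "F \<equiv> {f. moved f \<subseteq> U \<and> displacement f \<le> L}"
  shows "finite F" "real (card F) * a ^ L \<le> (2 / (1 - a)) ^ (2 * card U)"
proof -
  let ?V = "{v. v \<in> extensional U \<and> (\<Sum>y\<in>U. norm1 (v y)) \<le> L}"
  let ?d = "\<lambda>f. restrict (\<lambda>y. f y - y) U"
  have inj: "inj_on ?d F"
  proof (rule inj_onI)
    fix f g assume fg: "f \<in> F" "g \<in> F" "?d f = ?d g"
    have "f y = g y" for y
    proof (cases "y \<in> U")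
      case True
      then show ?thesis using fun_cong[OF fg(3), of y] by simp
    next
      case False
      then have "y \<notin> moved f" "y \<notin> moved g" using fg(1,2) by (auto simp: F_def)
      then show ?thesis by (simp add: moved_def)
    qed
    then show "f = g" by auto
  qed
  have sub: "?d ` F \<subseteq> ?V"
    using displacement_superset[OF U] by (auto simp: F_def cong: sum.cong)
  note V = card_bounded_total_norm_le[OF a U, of L]
  show "finite F" using inj_on_finite[OF inj sub V(1)] .
  have "card F \<le> card ?V" using inj sub V(1) by (rule card_inj_on_le)
  then have "real (card F) * a ^ L \<le> real (card ?V) * a ^ L"
    using a by (intro mult_right_mono) auto
  also note V(2)
  finally show "real (card F) * a ^ L \<le> (2 / (1 - a)) ^ (2 * card U)" .
qed

text \<open>A union bound over the possible ranges. Every factor is put in the form of an m-th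
  power, even the at most m choices of the end point, which are bounded by 2^m; the base then
  depends on neither m nor L.\<close>

lemma card_shuffler_small_range_le:
  fixes a :: real and Z F0 :: "(int \<times> int) set" and m L :: nat
  assumes a: "0 < a" "a < 1" and Z: "finite Z" and F0: "finite F0"
  defines "S \<equiv> {(f, x). \<exists>l. set l \<subseteq> Z \<and> card (partial_sums l) \<le> m \<and> x \<in> partial_sums l \<and>
    moved f \<subseteq> sumset (partial_sums l) F0 \<and> displacement f \<le> L}"
  shows "finite S"
    "real (card S) * a ^ L \<le> ((2 * real (card Z) + 1)\<^sup>2 * 2 * (2 / (1 - a)) ^ (2 * card F0)) ^ m"
proof -
  define R where "R = {U. card U \<le> m \<and> (\<exists>l. set l \<subseteq> Z \<and> partial_sums l = U)}"
  define T where "T U = {f. moved f \<subseteq> sumset U F0 \<and> displacement f \<le> L} \<times> U" for U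
  have R: "finite R" "card R \<le> (2 * card Z + 1) ^ (2 * m)"
    unfolding R_def using card_ranges_le[OF Z] by auto
  have finU: "finite U" if "U \<in> R" for U using that by (auto simp: R_def)
  have S: "S = (\<Union>U\<in>R. T U)"
    by (auto simp: S_def R_def T_def)
  have finT: "finite (T U)" if "U \<in> R" for U
    unfolding T_def using card_small_displacement_le(1)[OF a finite_sumset[OF finU[OF that] F0]] finU[OF that]
    by auto
  show "finite S" unfolding S using R(1) finT by blast
  let ?b = "2 / (1 - a)"
  have b: "?b \<ge> 1" using a by simp
  have T: "real (card (T U)) * a ^ L \<le> 2 ^ m * ?b ^ (2 * (m * card F0))" if "U \<in> R" for U
  proof -
    let ?F = "{f. moved f \<subseteq> sumset U F0 \<and> displacement f \<le> L}"
    have cU: "card U \<le> m" using that by (auto simp: R_def)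
    have "real (card (T U)) * a ^ L = real (card U) * (real (card ?F) * a ^ L)"
      by (simp add: T_def card_cartesian_product)
    also have "\<dots> \<le> 2 ^ m * ?b ^ (2 * (m * card F0))"
    proof (rule mult_mono)
      have "card U \<le> 2 ^ m" using cU less_exp[of m] by linarith
      then show "real (card U) \<le> 2 ^ m" by (metis of_nat_le_iff of_nat_numeral of_nat_power)
      have "card (sumset U F0) \<le> m * card F0"
        using card_sumset_le[OF finU[OF that] F0] cU by (meson le_trans mult_le_mono1)
      then have "?b ^ (2 * card (sumset U F0)) \<le> ?b ^ (2 * (m * card F0))"
        using b by (intro power_increasing) auto
      then show "real (card ?F) * a ^ L \<le> ?b ^ (2 * (m * card F0))"
        using card_small_displacement_le(2)[OF a finite_sumset[OF finU[OF that] F0], of L] by linarith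
    qed (use a in auto)
    finally show ?thesis .
  qed
  have "real (card S) \<le> (\<Sum>U\<in>R. real (card (T U)))"
    unfolding S using card_UN_le[OF R(1), of T] by (simp flip: of_nat_sum)
  then have "real (card S) * a ^ L \<le> (\<Sum>U\<in>R. real (card (T U))) * a ^ L"
    using a by (intro mult_right_mono) auto
  also have "\<dots> \<le> (\<Sum>U\<in>R. 2 ^ m * ?b ^ (2 * (m * card F0)))"
    unfolding sum_distrib_right by (intro sum_mono T)
  also have "\<dots> = real (card R) * (2 ^ m * ?b ^ (2 * (m * card F0)))" by simp
  also have "\<dots> \<le> real ((2 * card Z + 1) ^ (2 * m)) * (2 ^ m * ?b ^ (2 * (m * card F0)))"
  proof (rule mult_right_mono)
    show "real (card R) \<le> real ((2 * card Z + 1) ^ (2 * m))"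
      using R(2) by (rule of_nat_mono)
  qed (use b in auto)
  also have "\<dots> = ((2 * real (card Z) + 1)\<^sup>2 * 2 * ?b ^ (2 * card F0)) ^ m"
    by (simp add: power_mult_distrib power_mult[symmetric] ac_simps)
  finally show "real (card S) * a ^ L \<le> ((2 * real (card Z) + 1)\<^sup>2 * 2 * ?b ^ (2 * card F0)) ^ m" .
qed

theorem proposition6p2:
  fixes \<mu> :: "((int \<times> int \<Rightarrow> int \<times> int) \<times> (int \<times> int)) pmf"
  assumes "set_pmf \<mu> \<subseteq> carrier Shuffler_Z2"
    and "finite (set_pmf \<mu>)"
    and "recurrent_walk Z2 (map_pmf snd \<mu>)"
  shows "trivial_Poisson_boundary Shuffler_Z2 \<mu>"
proof -
  interpret W: countable_random_walk Shuffler_Z2 \<mu>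
    by (rule countable_random_walk.intro[OF group_Shuffler], unfold_locales)
      (use assms countable_carrier_Shuffler in auto)
  define Z where "Z = snd ` set_pmf \<mu>"
  define F0 where "F0 = (\<Union>s\<in>set_pmf \<mu>. moved (fst s))"
  define C where "C = Max ((\<lambda>s. displacement (fst s)) ` set_pmf \<mu>)"
  have Z: "finite Z" using assms(2) by (simp add: Z_def)
  have step: "bij (fst s)" "finite (moved (fst s))" "moved (fst s) \<subseteq> F0" "displacement (fst s) \<le> C"
    if "s \<in> set_pmf \<mu>" for s
    using that assms(1,2) by (auto simp: carrier_Shuffler F0_def C_def subset_eq)
  have F0: "finite F0" using step assms(2) by (auto simp: F0_def)
  \<comment> \<open>The first letter acts untranslated, near the visited point 0; the permutation of
    the remaining word is translated by the first step, exactly as its visited points are.\<close>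
  have word: "snd (W.word_value l) = sum_list (map snd l) \<and>
      moved (fst (W.word_value l)) \<subseteq> sumset (partial_sums (map snd l)) F0 \<and>
      displacement (fst (W.word_value l)) \<le> C * length l"
    if "l \<in> lists (set_pmf \<mu>)" for l
    using that
  proof (induction l)
    case Nil
    then show ?case by (simp add: W.word_value_def one_Shuffler moved_def displacement_def)
  next
    case (Cons s l)
    obtain f z where s: "s = (f, z)" by (cases s)
    obtain g x where g: "W.word_value l = (g, x)" by (cases "W.word_value l")
    have "(g, x) \<in> carrier Shuffler_Z2" using W.word_value_closed[OF Cons.hyps(2)] g by simp
    then have bg: "bij g" "finite (moved g)" by (auto simp: carrier_Shuffler)
    have sl: "W.word_value (s # l) = (f \<circ> translate z g, z + x)"
      using g by (simp add: W.word_value_def s mult_Shuffler)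
    have f: "bij f" "finite (moved f)" "moved f \<subseteq> F0" "displacement f \<le> C"
      using step[OF Cons.hyps(1)] by (auto simp: s)
    have IH: "x = sum_list (map snd l)" "moved g \<subseteq> sumset (partial_sums (map snd l)) F0"
      "displacement g \<le> C * length l"
      using Cons.IH g by auto
    have "moved f \<subseteq> sumset (partial_sums (map snd (s # l))) F0"
    proof
      fix y assume "y \<in> moved f"
      then show "y \<in> sumset (partial_sums (map snd (s # l))) F0"
        using f(3) unfolding sumset_def by (intro image_eqI[of _ _ "(0, y)"]) auto
    qed
    moreover have "moved (translate z g) \<subseteq> sumset (partial_sums (map snd (s # l))) F0"
    proof
      fix y assume "y \<in> moved (translate z g)"
      then obtain r u where "y = z + (r + u)" "r \<in> partial_sums (map snd l)" "u \<in> F0"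
        using IH(2) by (auto simp: moved_translate sumset_def)
      then show "y \<in> sumset (partial_sums (map snd (s # l))) F0"
        unfolding sumset_def by (intro image_eqI[of _ _ "(z + r, u)"]) (auto simp: s add.assoc)
    qed
    ultimately have 1: "moved (f \<circ> translate z g) \<subseteq> sumset (partial_sums (map snd (s # l))) F0"
      using moved_comp[of f "translate z g"] by blast
    have "displacement (f \<circ> translate z g) \<le> displacement f + displacement (translate z g)"
      using f bg by (intro displacement_comp_le bij_translate) (auto simp: moved_translate)
    moreover have "C * length (s # l) = C + C * length l" by simp
    ultimately have 2: "displacement (f \<circ> translate z g) \<le> C * length (s # l)"
      using IH(3) f(4) unfolding displacement_translate by linarith
    show ?case
      unfolding sl fst_conv snd_conv using 1 2 IH(1) by (intro conjI) (simp_all only: s list.map sum_list.Cons snd_conv)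
  qed
  show ?thesis
  proof (rule W.trivial_Poisson_boundary_if_entropy_sublinear)
    fix \<epsilon> :: real assume \<epsilon>: "\<epsilon> > 0"
    define K where "K = card (set_pmf \<mu>)"
    have K: "K \<ge> 1" using assms(2) set_pmf_not_empty[of \<mu>] by (simp add: K_def Suc_le_eq card_gt_0_iff)
    \<comment> \<open>Makes a^(-C n) at most exp(epsilon n / 4). The summand 1 covers C = 0 and
      keeps a below 1.\<close>
    define a where "a = exp (- (\<epsilon> / (4 * (real C + 1))))"
    have a: "0 < a" "a < 1" using \<epsilon> by (auto simp: a_def)
    define B where "B = (2 * real (card Z) + 1)\<^sup>2 * 2 * (2 / (1 - a)) ^ (2 * card F0)"
    have B: "B \<ge> 1"
    proof -
      have "1 * 1 * 1 \<le> B" unfolding B_def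
        using a by (intro mult_mono one_le_power) auto
      then show ?thesis by simp
    qed
    have lnB: "ln B \<ge> 0" and lnK: "ln K \<ge> 0" using B K by auto
    \<comment> \<open>The tolerated proportion of visited points: m \<le> \<delta> n gives m ln B
      \<le> epsilon n / 4.\<close>
    define \<delta> where "\<delta> = \<epsilon> / (4 * (ln B + 1))"
    have \<delta>: "\<delta> > 0" using \<epsilon> lnB by (simp add: \<delta>_def)
    \<comment> \<open>The tolerated probability of a larger range: \<open>\<eta>\<close> times n ln
      K, the trivial entropy bound, is at most epsilon n / 4. An expected range of at most \<delta>
      \<eta> n yields this probability by Markov's inequality.\<close>
    define \<eta> where "\<eta> = \<epsilon> / (4 * (ln K + 1))"
    have \<eta>: "\<eta> > 0" using \<epsilon> lnK by (simp add: \<eta>_def)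
    have "finite (set_pmf (map_pmf snd \<mu>))" using assms(2) by simp
    from expected_range_sublinear[OF this assms(3), of "\<delta> * \<eta>"] \<delta> \<eta> obtain n0 where n0:
      "\<And>n. n \<ge> n0 \<Longrightarrow> measure_pmf.expectation (replicate_pmf n (map_pmf snd \<mu>))
        (\<lambda>l. real (card (partial_sums l))) \<le> \<delta> * \<eta> * real n" by auto
    obtain n1 :: nat where n1: "real n1 \<ge> 1 / \<delta>" using real_arch_simple by blast
    obtain n2 :: nat where n2: "real n2 \<ge> ln 2 / (\<epsilon> / 4)" using real_arch_simple by blast
    define n where "n = max (max n0 n1) (max n2 1)"
    have n: "n \<ge> n0" "real n \<ge> 1 / \<delta>" "real n \<ge> ln 2 / (\<epsilon> / 4)" "n > 0"
      using n1 n2 by (auto simp: n_def)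
    define m where "m = nat \<lfloor>\<delta> * real n\<rfloor>"
    have "\<delta> * real n \<ge> 1" using n(2) \<delta> by (simp add: pos_divide_le_eq mult.commute)
    then have m: "m \<ge> 1" "real m \<le> \<delta> * real n" "\<delta> * real n < real (Suc m)"
      by (auto simp: m_def le_nat_floor) linarith+
    define S where "S = {(f, x). \<exists>l. set l \<subseteq> Z \<and> card (partial_sums l) \<le> m \<and> x \<in> partial_sums l \<and>
      moved f \<subseteq> sumset (partial_sums l) F0 \<and> displacement f \<le> C * n}"
    have S: "finite S" "real (card S) * a ^ (C * n) \<le> B ^ m"
      unfolding S_def B_def by (rule card_shuffler_small_range_le[OF a Z F0])+
    \<comment> \<open>Even the empty word visits 0, which is why n was taken large enough for m
      \<ge> 1.\<close>
    have "(id, 0) \<in> S"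
      unfolding S_def using m(1) by (auto intro!: exI[of _ "[]"] simp: moved_def displacement_def)
    then have Sne: "S \<noteq> {}" by auto
    have lnS: "ln (card S) \<le> \<epsilon> / 4 * real n + \<epsilon> / 4 * real n"
    proof -
      have cS: "real (card S) > 0" using S(1) Sne by (simp add: card_gt_0_iff)
      have "ln (real (card S) * a ^ (C * n)) \<le> ln (B ^ m)"
        using S(2) cS a by (intro ln_mono) auto
      then have "ln (card S) + real (C * n) * ln a \<le> real m * ln B"
        using cS a B by (simp add: ln_mult ln_realpow)
      moreover have "real (C * n) * - ln a \<le> \<epsilon> / 4 * real n"
      proof -
        have "real C * (\<epsilon> / (4 * (real C + 1))) \<le> \<epsilon> / 4"
          using \<epsilon> by (simp add: field_simps)
        then have "real C * (\<epsilon> / (4 * (real C + 1))) * real n \<le> \<epsilon> / 4 * real n"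
          by (rule mult_right_mono) simp
        then show ?thesis by (simp add: a_def ac_simps)
      qed
      moreover have "real m * ln B \<le> \<epsilon> / 4 * real n"
      proof -
        have "real m * ln B \<le> \<delta> * real n * ln B" using m(2) lnB by (rule mult_right_mono)
        also have "\<dots> = \<delta> * ln B * real n" by simp
        also have "\<dots> \<le> \<epsilon> / 4 * real n"
          using \<epsilon> lnB by (intro mult_right_mono) (simp_all add: \<delta>_def field_simps)
        finally show ?thesis .
      qed
      ultimately show ?thesis by linarith
    qed
    have fin_words: "finite {l. set l \<subseteq> set_pmf \<mu> \<and> length l = n}"
      using assms(2) by (rule finite_lists_length_eq)
    have set_words: "set_pmf (replicate_pmf n \<mu>) = {l. set l \<subseteq> set_pmf \<mu> \<and> length l = n}"
      by (auto simp: set_replicate_pmf)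
    have cardK: "card (set_pmf (W.walk_pmf n)) \<le> K ^ n"
      unfolding W.walk_pmf_def set_map_pmf set_words K_def
      using card_image_le[OF fin_words] by (simp add: card_lists_length_eq[OF assms(2)])
    have prob: "measure_pmf.prob (W.walk_pmf n) (- S) \<le> \<eta>"
    proof -
      let ?c = "\<lambda>l. real (card (partial_sums (map snd l)))"
      have "measure_pmf.prob (W.walk_pmf n) (- S) = measure_pmf.prob (replicate_pmf n \<mu>) (W.word_value -` (- S))"
        by (simp add: W.walk_pmf_def)
      also have "\<dots> \<le> measure_pmf.prob (replicate_pmf n \<mu>) {l. ?c l \<ge> real (Suc m)}"
      proof (rule measure_pmf.finite_measure_mono_AE)
        show "AE l in replicate_pmf n \<mu>. l \<in> W.word_value -` (- S) \<longrightarrow> l \<in> {l. ?c l \<ge> real (Suc m)}"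
          unfolding AE_measure_pmf_iff
        proof (intro ballI impI)
          fix l assume l: "l \<in> set_pmf (replicate_pmf n \<mu>)" and notS: "l \<in> W.word_value -` (- S)"
          have l': "l \<in> lists (set_pmf \<mu>)" "length l = n" using l by (auto simp: set_replicate_pmf)
          have lZ: "set (map snd l) \<subseteq> Z"
            using l by (simp add: Z_def set_words image_mono)
          have "\<not> card (partial_sums (map snd l)) \<le> m"
          proof
            assume "card (partial_sums (map snd l)) \<le> m"
            then have "W.word_value l \<in> S"
              using word[OF l'(1)] l'(2) lZ sum_list_in_partial_sums[of "map snd l"]
              unfolding S_def by (auto simp: case_prod_beta simp del: set_map intro!: exI[of _ "map snd l"])
            then show False using notS by simp
          qed
          then show "l \<in> {l. ?c l \<ge> real (Suc m)}" by simp
        qed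
      qed simp
      also have "\<dots> \<le> measure_pmf.expectation (replicate_pmf n \<mu>) ?c / real (Suc m)"
        using integral_Markov_inequality_measure[of "measure_pmf (replicate_pmf n \<mu>)" ?c UNIV "real (Suc m)"]
        by (simp add: integrable_measure_pmf_finite set_words fin_words)
      also have "measure_pmf.expectation (replicate_pmf n \<mu>) ?c \<le> \<delta> * \<eta> * real n"
        using n0[OF n(1)] by (simp add: replicate_pmf_map)
      also have "\<delta> * \<eta> * real n / real (Suc m) \<le> \<eta>"
      proof -
        have "\<eta> * (\<delta> * real n) \<le> \<eta> * real (Suc m)"
          using m(3) \<eta> by (intro mult_left_mono) auto
        then show ?thesis by (simp add: pos_divide_le_eq ac_simps del: of_nat_Suc)
      qed
      finally show ?thesis by (simp add: divide_right_mono)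
    qed
    have "pmf_entropy (W.walk_pmf n) \<le> ln 2 + ln (card S) + measure_pmf.prob (W.walk_pmf n) (- S) * ln (K ^ n)"
      using pmf_entropy_le_concentration[OF W.finite_walk_pmf S(1) Sne cardK] by simp
    \<comment> \<open>The four quarters of epsilon pay for ln 2, the undone weights, the power B^m
      and the exceptional event.\<close>
    also have "\<dots> \<le> \<epsilon> / 4 * real n + (\<epsilon> / 4 * real n + \<epsilon> / 4 * real n) + \<epsilon> / 4 * real n"
    proof (intro add_mono lnS)
      show "ln 2 \<le> \<epsilon> / 4 * real n" using n(3) \<epsilon> by (simp add: pos_divide_le_eq field_simps)
      have "measure_pmf.prob (W.walk_pmf n) (- S) * ln (K ^ n) \<le> \<eta> * (real n * ln K)"
        using prob lnK K by (simp add: ln_realpow mult_right_mono)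
      also have "\<dots> = \<eta> * ln K * real n" by simp
      also have "\<dots> \<le> \<epsilon> / 4 * real n"
        using \<epsilon> lnK by (intro mult_right_mono) (simp_all add: \<eta>_def field_simps)
      finally show "measure_pmf.prob (W.walk_pmf n) (- S) * ln (K ^ n) \<le> \<epsilon> / 4 * real n" .
    qed
    also have "\<dots> = \<epsilon> * real n" by simp
    finally show "\<exists>N>0. pmf_entropy (W.walk_pmf N) \<le> \<epsilon> * real N" using n(4) by blast
  qed
qed

end
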